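(* Let $(X,g)$ be a $2$-dimensional smooth connected Riemannian manifold without boundary, and let $Y\subset X$ be a $2$-dimensional compact connected $C^0$-submanifold with nonempty boundary $\partial Y$. For $x,y\in Y$ put $$\rho_Y(x,y)=\liminf_{x'\to x,\; y'\to y;\; x',y'\in \mathrm{Int}\,Y}\ \inf\{\, l(\gamma)\,\},$$ where the infimum is over all smooth paths $\gamma:[0,1]\to \mathrm{Int}\,Y$ with $\gamma(0)=x'$, $\gamma(1)=y'$. Suppose that $\rho_Y(x,y)<\infty$ for all $x,y\in Y$. Then $\rho_Y$ is a metric on $Y$.
   Context: A $C^0$-submanifold with boundary of dimension $n=\dim X$ in $X$ is a subset of $X$ which, with the subspace topology, is a topological $n$-manifold with boundary. $\mathrm{Int}\,Y$ and $\partial Y$ denote its interior and boundary. $l(\gamma)$ denotes the length of a path $\gamma$ with respect to the Riemannian metric $g$. *)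

theory Defs
  imports "HOL-Analysis.Analysis"
begin

text \<open>\<open>Ck_on k U f\<close> is meant for open sets \<open>U\<close> of a finite-dimensional space: there, \<open>f\<close> is \<open>C\<^sup>k\<close>
  iff it is differentiable and all its directional derivatives are \<open>k - 1\<close> times
  continuously differentiable.\<close>

primrec Ck_on :: "nat \<Rightarrow> 'a::real_normed_vector set \<Rightarrow> ('a \<Rightarrow> 'b::real_normed_vector) \<Rightarrow> bool" where
  "Ck_on 0 U f \<longleftrightarrow> continuous_on U f"
| "Ck_on (Suc k) U f \<longleftrightarrow>
     (\<forall>x\<in>U. f differentiable (at x)) \<and> (\<forall>v. Ck_on k U (\<lambda>x. frechet_derivative f (at x) v))"

text \<open>On a set that need not be open (such as \<open>[0,1]\<close>), smooth means locally extendable to a smooth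
  map on an open neighbourhood.  On open sets this is ordinary \<open>C\<^sup>\<infinity>\<close> smoothness.\<close>

definition smooth_on :: "'a::real_normed_vector set \<Rightarrow> ('a \<Rightarrow> 'b::real_normed_vector) \<Rightarrow> bool" where
  "smooth_on S f \<longleftrightarrow>
     (\<forall>x\<in>S. \<exists>U F. open U \<and> x \<in> U \<and> (\<forall>k. Ck_on k U F) \<and> (\<forall>y\<in>S \<inter> U. F y = f y))"

text \<open>The manifold is the whole type \<open>'a\<close>; being Hausdorff and second countable is left to the
  type classes \<open>t2_space\<close> and \<open>second_countable_topology\<close>.  A chart consists of its
  domain and its coordinate map; the values of the map off the domain are irrelevant.\<close>

type_synonym 'a chart = "'a set \<times> ('a \<Rightarrow> real^2)"

definition transition :: "'a chart \<Rightarrow> 'a chart \<Rightarrow> real^2 \<Rightarrow> real^2" where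
  "transition c d = snd d \<circ> inv_into (fst c) (snd c)"

definition smooth_atlas :: "'a::topological_space chart set \<Rightarrow> bool" where
  "smooth_atlas A \<longleftrightarrow>
     (\<Union>c\<in>A. fst c) = UNIV \<and>
     (\<forall>(U, \<phi>)\<in>A. open U \<and> open (\<phi> ` U) \<and> homeomorphism U (\<phi> ` U) \<phi> (inv_into U \<phi>)) \<and>
     (\<forall>c\<in>A. \<forall>d\<in>A. smooth_on (snd c ` (fst c \<inter> fst d)) (transition c d))"

text \<open>A Riemannian metric is given by its coordinate representations: \<open>g c p v w\<close> is the inner
  product of the tangent vectors at \<open>p\<close> whose coordinates with respect to the chart \<open>c\<close> are \<open>v\<close>
  and \<open>w\<close>.  The last clause says that all charts represent the same inner product on the tangent
  space at \<open>p\<close>.\<close>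

type_synonym 'a metric_tensor = "'a chart \<Rightarrow> 'a \<Rightarrow> real^2 \<Rightarrow> real^2 \<Rightarrow> real"

definition riemannian_metric :: "'a chart set \<Rightarrow> 'a metric_tensor \<Rightarrow> bool" where
  "riemannian_metric A g \<longleftrightarrow>
     (\<forall>c\<in>A. \<forall>p\<in>fst c. bilinear (g c p) \<and> (\<forall>v w. g c p v w = g c p w v) \<and>
        (\<forall>v. v \<noteq> 0 \<longrightarrow> 0 < g c p v v)) \<and>
     (\<forall>c\<in>A. \<forall>v w. smooth_on (snd c ` fst c) (\<lambda>x. g c (inv_into (fst c) (snd c) x) v w)) \<and>
     (\<forall>c\<in>A. \<forall>d\<in>A. \<forall>p\<in>fst c \<inter> fst d. \<forall>v w.
        g d p (frechet_derivative (transition c d) (at (snd c p)) v)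
              (frechet_derivative (transition c d) (at (snd c p)) w) = g c p v w)"

definition smooth_path :: "'a::topological_space chart set \<Rightarrow> (real \<Rightarrow> 'a) \<Rightarrow> bool" where
  "smooth_path A \<gamma> \<longleftrightarrow>
     path \<gamma> \<and> (\<forall>c\<in>A. smooth_on {t\<in>{0..1}. \<gamma> t \<in> fst c} (snd c \<circ> \<gamma>))"

definition chart_at :: "'a chart set \<Rightarrow> 'a \<Rightarrow> 'a chart" where
  "chart_at A p = (SOME c. c \<in> A \<and> p \<in> fst c)"

text \<open>For a Riemannian metric, the speed does not depend on which chart around \<open>\<gamma> t\<close> is chosen.
  The derivative is taken within \<open>[0,1]\<close> since \<open>\<gamma>\<close> is unconstrained outside.\<close>

definition speed :: "'a chart set \<Rightarrow> 'a metric_tensor \<Rightarrow> (real \<Rightarrow> 'a) \<Rightarrow> real \<Rightarrow> real" where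
  "speed A g \<gamma> t =
     (let c = chart_at A (\<gamma> t); v = vector_derivative (snd c \<circ> \<gamma>) (at t within {0..1})
      in sqrt (g c (\<gamma> t) v v))"

definition path_length :: "'a chart set \<Rightarrow> 'a metric_tensor \<Rightarrow> (real \<Rightarrow> 'a) \<Rightarrow> real" where
  "path_length A g \<gamma> = integral {0..1} (speed A g \<gamma>)"

definition half_plane :: "(real^2) set" where
  "half_plane = {x. 0 \<le> x $ 2}"

text \<open>The subset \<open>Y\<close> with its subspace topology is a topological \<open>2\<close>-manifold with boundary.  The
  Hausdorff property and second countability are inherited from the ambient type.\<close>

definition C0_submanifold_with_boundary :: "'a::{t2_space,second_countable_topology} set \<Rightarrow> bool"
  where
  "C0_submanifold_with_boundary Y \<longleftrightarrow>
     (\<forall>p\<in>Y. \<exists>V W. openin (top_of_set Y) V \<and> p \<in> V \<and>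
        openin (top_of_set half_plane) W \<and> V homeomorphic W)"

text \<open>Intrinsic to the topology of \<open>Y\<close>; not the interior and frontier of \<open>Y\<close> in the ambient space.\<close>

definition manifold_interior :: "'a::topological_space set \<Rightarrow> 'a set" where
  "manifold_interior Y =
     {p\<in>Y. \<exists>V. \<exists>W :: (real^2) set. openin (top_of_set Y) V \<and> p \<in> V \<and> open W \<and> V homeomorphic W}"

definition manifold_boundary :: "'a::topological_space set \<Rightarrow> 'a set" where
  "manifold_boundary Y = Y - manifold_interior Y"

text \<open>The infimum is taken in the extended reals, so that it is \<open>\<infinity>\<close> when there is no path.\<close>

definition inner_dist ::
  "'a::topological_space chart set \<Rightarrow> 'a metric_tensor \<Rightarrow> 'a set \<Rightarrow> 'a \<Rightarrow> 'a \<Rightarrow> ereal" where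
  "inner_dist A g Y x' y' =
     (INF \<gamma>\<in>{\<gamma>. smooth_path A \<gamma> \<and> path_image \<gamma> \<subseteq> manifold_interior Y \<and>
               pathstart \<gamma> = x' \<and> pathfinish \<gamma> = y'}. ereal (path_length A g \<gamma>))"

text \<open>The points \<open>x'\<close> and \<open>y'\<close> tend to \<open>x\<close> and \<open>y\<close> inside the interior of \<open>Y\<close>; the values \<open>x' = x\<close>
  and \<open>y' = y\<close> are not excluded.\<close>

definition rho ::
  "'a::topological_space chart set \<Rightarrow> 'a metric_tensor \<Rightarrow> 'a set \<Rightarrow> 'a \<Rightarrow> 'a \<Rightarrow> ereal" where
  "rho A g Y x y =
     Liminf (inf (nhds x) (principal (manifold_interior Y)) \<times>\<^sub>F
             inf (nhds y) (principal (manifold_interior Y)))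
       (\<lambda>(x', y'). inner_dist A g Y x' y')"

end

theory Submission
  imports Defs
begin

text \<open>Only the triangle inequality at a point \<open>y\<close> of the boundary and the positivity of \<open>\<rho>\<close> need
  an argument.  Positivity holds because a path that leaves a coordinate disc about \<open>x\<close> has length
  bounded below.  For the triangle inequality, take paths in the interior of \<open>Y\<close> from points near
  \<open>y\<close> to points near \<open>x\<close> and near \<open>z\<close>; their starting points may be far apart for the inner
  distance.  An open half disc \<open>D \<subseteq> Y\<close> at \<open>y\<close> is homeomorphic to the plane, and a small
  coordinate circle \<open>S\<close> about \<open>y\<close> separates the points of \<open>D\<close> near \<open>y\<close> from a half circle
  around \<open>y\<close> that is fixed in advance.  In the plane some connected component of \<open>S \<inter> D\<close> already separates them.
  Both paths meet this component, which is an arc of \<open>S\<close> inside the interior of \<open>Y\<close>,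
  so that one can change from one path to the other at a cost tending to \<open>0\<close> with the radius of \<open>S\<close>.
  Reparametrising by a flat step function keeps the concatenation smooth.\<close>

section \<open>Calculus of \<open>C\<^sup>k\<close> maps\<close>

text \<open>As the boundary is only continuous, two interior points close to \<open>y\<close> can be
  joined inside the half disc, but perhaps only by long paths. So the two near-optimal paths cannot
  be joined at their ends near \<open>y\<close>; each is cut where it meets the circle, and an arc
  of the circle replaces the lost pieces. The circle lives in a smooth chart of the ambient surface,
  where lengths are comparable to Euclidean ones, the half disc in a merely topological chart of
  \<open>Y\<close>; only topological facts pass between the two. The circle may meet the interior in
  infinitely many arcs and the two paths might cross different ones, hence the need for a single arc
  that both must cross. That some component of a closed separating set separates already is a fact
  about the plane; it fails on an annulus, where two radial segments separate jointly but not
  singly. This is why the argument is confined to a piece homeomorphic to the plane. An interior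
  point \<open>y\<close> needs no other argument: its half disc is a whole disc. The cases
  \<open>y = x\<close> and \<open>y = z\<close> come down to
  \<open>\<rho>(y, y) = 0\<close>.\<close>

lemma Ck_on_cong:
  assumes "open U" "\<And>x. x \<in> U \<Longrightarrow> f x = g x" "Ck_on k U f"
  shows "Ck_on k U g"
  using assms(2,3)
proof (induction k arbitrary: f g)
  case 0
  then show ?case using continuous_on_cong by force
next
  case (Suc k)
  have d: "f differentiable (at x)" if "x \<in> U" for x
    using Suc.prems that by simp
  have "g differentiable (at x)" if x: "x \<in> U" for x
  proof -
    have "(f has_derivative frechet_derivative f (at x)) (at x)"
      using d[OF x] by (simp add: frechet_derivative_works)
    then have "(g has_derivative frechet_derivative f (at x)) (at x)"
      using has_derivative_transform_within_open[OF _ assms(1) x] Suc.prems(1) by blast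
    then show ?thesis by (auto simp: differentiable_def)
  qed
  moreover have "Ck_on k U (\<lambda>x. frechet_derivative g (at x) v)" for v
  proof (rule Suc.IH)
    show "frechet_derivative f (at x) v = frechet_derivative g (at x) v" if "x \<in> U" for x
      using frechet_derivative_transform_within_open[OF d[OF that] assms(1) that Suc.prems(1)]
      by simp
    show "Ck_on k U (\<lambda>x. frechet_derivative f (at x) v)"
      using Suc.prems(2) by simp
  qed
  ultimately show ?case by simp
qed

lemma Ck_on_subset: "Ck_on k U f \<Longrightarrow> V \<subseteq> U \<Longrightarrow> Ck_on k V f"
  by (induction k arbitrary: f) (auto intro: continuous_on_subset)

lemma Ck_on_SucD: "Ck_on (Suc k) U f \<Longrightarrow> Ck_on k U f"
proof (induction k arbitrary: f)
  case 0
  then have "isCont f x" if "x \<in> U" for x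
    using that differentiable_imp_continuous_within[of f x UNIV] by simp
  then show ?case
    by (simp add: continuous_at_imp_continuous_on)
next
  case (Suc k)
  have "Ck_on k U (\<lambda>x. frechet_derivative f (at x) v)" for v
    using Suc.IH Suc.prems unfolding Ck_on.simps(2)[of "Suc k"] by blast
  then show ?case
    using Suc.prems unfolding Ck_on.simps(2) by blast
qed

lemma Ck_on_continuous: "Ck_on k U f \<Longrightarrow> continuous_on U f"
proof (induction k)
  case (Suc k)
  show ?case by (rule Suc.IH[OF Ck_on_SucD[OF Suc.prems]])
qed simp

text \<open>Any explicit derivative \<open>f'\<close> may be supplied: uniqueness of the Frechet
  derivative identifies it on \<open>U\<close> with the one used in \<open>Ck_on\<close>.\<close>

lemma Ck_on_SucI:
  assumes "open U" "\<And>x. x \<in> U \<Longrightarrow> (f has_derivative f' x) (at x)"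
    and "\<And>v. Ck_on k U (\<lambda>x. f' x v)"
  shows "Ck_on (Suc k) U f"
proof -
  have "f' x v = frechet_derivative f (at x) v" if "x \<in> U" for x v
    using frechet_derivative_at[OF assms(2)[OF that]] by simp
  then have "Ck_on k U (\<lambda>x. frechet_derivative f (at x) v)" for v
    by (rule Ck_on_cong[OF assms(1) _ assms(3)[of v]])
  then show ?thesis using assms(2) by (auto simp: differentiable_def)
qed

lemma Ck_on_Suc_has_derivative:
  "Ck_on (Suc k) U f \<Longrightarrow> x \<in> U \<Longrightarrow> (f has_derivative frechet_derivative f (at x)) (at x)"
  by (simp add: frechet_derivative_works[symmetric])

lemma Ck_on_const: "Ck_on k U (\<lambda>x. c)"
proof (induction k arbitrary: c)
  case (Suc k)
  have "frechet_derivative (\<lambda>x. c) (at x) = (\<lambda>v. 0)" for x :: 'a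
    using frechet_derivative_at[OF has_derivative_const[of c "at x"]] by simp
  then show ?case using Suc by simp
qed simp

lemma Ck_on_bounded_linear:
  assumes "open U" "bounded_linear L" "Ck_on k U f"
  shows "Ck_on k U (\<lambda>x. L (f x))"
  using assms(3)
proof (induction k arbitrary: f)
  case 0
  then show ?case
    using bounded_linear.continuous_on[OF assms(2)] by simp
next
  case (Suc k)
  show ?case
  proof (rule Ck_on_SucI[OF assms(1)])
    show "((\<lambda>x. L (f x)) has_derivative (\<lambda>v. L (frechet_derivative f (at x) v))) (at x)"
      if "x \<in> U" for x
      using bounded_linear.has_derivative[OF assms(2) Ck_on_Suc_has_derivative[OF Suc.prems that]] .
    show "Ck_on k U (\<lambda>x. L (frechet_derivative f (at x) v))" for v
      using Suc by simp
  qed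
qed

lemma Ck_on_ident: "open U \<Longrightarrow> Ck_on k U (\<lambda>x. x)"
proof (cases k)
  case (Suc j)
  assume "open U"
  then show ?thesis unfolding Suc
    by (rule Ck_on_SucI[where f' = "\<lambda>x v. v"]) (rule has_derivative_ident Ck_on_const)+
qed simp

lemma Ck_on_add:
  assumes "open U" "Ck_on k U f" "Ck_on k U g"
  shows "Ck_on k U (\<lambda>x. f x + g x)"
  using assms(2,3)
proof (induction k arbitrary: f g)
  case 0
  then show ?case by (simp add: continuous_on_add)
next
  case (Suc k)
  show ?case
  proof (rule Ck_on_SucI[OF assms(1)])
    show "((\<lambda>x. f x + g x) has_derivative
        (\<lambda>v. frechet_derivative f (at x) v + frechet_derivative g (at x) v)) (at x)"
      if "x \<in> U" for x
      by (rule has_derivative_add[OF Ck_on_Suc_has_derivative[OF Suc.prems(1) that]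
            Ck_on_Suc_has_derivative[OF Suc.prems(2) that]])
    show "Ck_on k U (\<lambda>x. frechet_derivative f (at x) v + frechet_derivative g (at x) v)" for v
      using Suc by simp
  qed
qed

lemma Ck_on_sum:
  assumes "open U" "finite I" "\<And>i. i \<in> I \<Longrightarrow> Ck_on k U (f i)"
  shows "Ck_on k U (\<lambda>x. \<Sum>i\<in>I. f i x)"
  using assms(2,3)
proof (induction I)
  case empty
  then show ?case by (simp add: Ck_on_const)
next
  case (insert i I)
  then show ?case by (simp add: Ck_on_add[OF assms(1)])
qed

lemma Ck_on_scaleR:
  fixes f :: "'a::real_normed_vector \<Rightarrow> real"
  assumes "open U" "Ck_on k U f" "Ck_on k U g"
  shows "Ck_on k U (\<lambda>x. f x *\<^sub>R g x)"
  using assms(2,3)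
proof (induction k arbitrary: f g)
  case 0
  then show ?case by (simp add: continuous_on_scaleR)
next
  case (Suc k)
  show ?case
  proof (rule Ck_on_SucI[OF assms(1)])
    show "((\<lambda>x. f x *\<^sub>R g x) has_derivative
        (\<lambda>v. f x *\<^sub>R frechet_derivative g (at x) v + frechet_derivative f (at x) v *\<^sub>R g x)) (at x)"
      if "x \<in> U" for x
      by (rule has_derivative_scaleR[OF Ck_on_Suc_has_derivative[OF Suc.prems(1) that]
            Ck_on_Suc_has_derivative[OF Suc.prems(2) that]])
    show "Ck_on k U (\<lambda>x. f x *\<^sub>R frechet_derivative g (at x) v + frechet_derivative f (at x) v *\<^sub>R g x)" for v
      using Suc.prems Ck_on_SucD[OF Suc.prems(1)] Ck_on_SucD[OF Suc.prems(2)]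
      by (auto intro!: Ck_on_add[OF assms(1)] Suc.IH)
  qed
qed

lemma Ck_on_mult:
  fixes f g :: "'a::real_normed_vector \<Rightarrow> real"
  assumes "open U" "Ck_on k U f" "Ck_on k U g"
  shows "Ck_on k U (\<lambda>x. f x * g x)"
  using Ck_on_scaleR[OF assms] by simp

lemma Ck_on_inverse:
  fixes f :: "'a::real_normed_vector \<Rightarrow> real"
  assumes "open U" "Ck_on k U f" "\<And>x. x \<in> U \<Longrightarrow> f x \<noteq> 0"
  shows "Ck_on k U (\<lambda>x. inverse (f x))"
  using assms(2)
proof (induction k)
  case 0
  then show ?case using assms(3) by (auto intro: continuous_on_inverse)
next
  case (Suc k)
  have I: "Ck_on k U (\<lambda>x. inverse (f x))"
    by (rule Suc.IH[OF Ck_on_SucD[OF Suc.prems]])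
  show ?case
  proof (rule Ck_on_SucI[OF assms(1)])
    show "((\<lambda>x. inverse (f x)) has_derivative
        (\<lambda>v. - 1 * (inverse (f x) * frechet_derivative f (at x) v * inverse (f x)))) (at x)"
      if "x \<in> U" for x
      using Deriv.has_derivative_inverse[OF assms(3)[OF that] Ck_on_Suc_has_derivative[OF Suc.prems that]]
      by simp
    show "Ck_on k U (\<lambda>x. - 1 * (inverse (f x) * frechet_derivative f (at x) v * inverse (f x)))" for v
      using Suc.prems I by (intro Ck_on_mult[OF assms(1)] Ck_on_const) auto
  qed
qed

text \<open>\<open>Ck_on\<close> controls derivatives in fixed directions only. The chain rule is
  therefore expanded over \<open>Basis\<close>, into products of coordinates of the derivative of
  \<open>c\<close> with directional derivatives of \<open>F\<close> taken along \<open>c\<close>. To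
  the latter the induction hypothesis applies, with the same \<open>c\<close> and a new outer
  function.\<close>

lemma Ck_on_compose:
  fixes c :: "'a::real_normed_vector \<Rightarrow> 'b::euclidean_space"
    and F :: "'b \<Rightarrow> 'c::real_normed_vector"
  assumes "open T" "open U" "c ` T \<subseteq> U" "Ck_on k T c" "Ck_on k U F"
  shows "Ck_on k T (\<lambda>x. F (c x))"
  using assms(4,5)
proof (induction k arbitrary: F)
  case 0
  then show ?case using continuous_on_compose2[OF _ _ assms(3), of F] by simp
next
  case (Suc k)
  have ck: "Ck_on k T c" by (rule Ck_on_SucD[OF Suc.prems(1)])
  let ?F' = "\<lambda>x. frechet_derivative F (at x)" and ?c' = "\<lambda>x. frechet_derivative c (at x)"
  have dF: "(F has_derivative ?F' (c x)) (at (c x))" if "x \<in> T" for x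
    by (rule Ck_on_Suc_has_derivative[OF Suc.prems(2)]) (use that assms(3) in auto)
  show ?case
  proof (rule Ck_on_SucI[OF assms(1)])
    show "((\<lambda>x. F (c x)) has_derivative (\<lambda>v. \<Sum>b\<in>Basis. (?c' x v \<bullet> b) *\<^sub>R ?F' (c x) b)) (at x)"
      if x: "x \<in> T" for x
    proof -
      have lin: "linear (?F' (c x))"
        by (rule has_derivative_linear[OF dF[OF x]])
      have rep: "?F' (c x) w = (\<Sum>b\<in>Basis. (w \<bullet> b) *\<^sub>R ?F' (c x) b)" for w
      proof -
        have "?F' (c x) w = ?F' (c x) (\<Sum>b\<in>Basis. (w \<bullet> b) *\<^sub>R b)"
          by (simp add: euclidean_representation)
        then show ?thesis
          by (simp add: linear_sum[OF lin] linear_cmul[OF lin])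
      qed
      have "(\<lambda>v. \<Sum>b\<in>Basis. (?c' x v \<bullet> b) *\<^sub>R ?F' (c x) b) = (\<lambda>v. ?F' (c x) (?c' x v))"
        by (intro ext) (rule rep[symmetric])
      then show ?thesis
        using has_derivative_compose[OF Ck_on_Suc_has_derivative[OF Suc.prems(1) x] dF[OF x]]
        by (simp only:)
    qed
    show "Ck_on k T (\<lambda>x. \<Sum>b\<in>Basis. (?c' x v \<bullet> b) *\<^sub>R ?F' (c x) b)" for v
    proof (intro Ck_on_sum[OF assms(1)] Ck_on_scaleR[OF assms(1)] finite_Basis)
      fix b :: 'b
      show "Ck_on k T (\<lambda>x. ?c' x v \<bullet> b)"
        using Ck_on_bounded_linear[OF assms(1) bounded_linear_inner_left] Suc.prems(1)
        unfolding Ck_on.simps by blast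
      show "Ck_on k T (\<lambda>x. ?F' (c x) b)"
        using Suc.prems(2) unfolding Ck_on.simps by (intro Suc.IH ck) blast
    qed
  qed
qed

section \<open>Affine changes of parameter and a smooth step on the line\<close>

lemma Ck_on_affine: "Ck_on k UNIV (\<lambda>x::real. b * x + a)"
  by (intro Ck_on_add Ck_on_mult Ck_on_const Ck_on_ident open_UNIV)

lemma DERIV_affine: "((\<lambda>x::real. b * x + a) has_real_derivative b) (at t)"
  by (auto intro!: derivative_eq_intros)

text \<open>The span of these functions is closed under differentiation, hence they are smooth at \<open>0\<close>.\<close>

definition flat_exp :: "nat \<Rightarrow> real \<Rightarrow> real" where
  "flat_exp n x = (if x > 0 then inverse x ^ n * exp (- inverse x) else 0)"

lemma flat_exp_tendsto_0: "((\<lambda>x. flat_exp n x) \<longlongrightarrow> 0) (at 0)"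
proof -
  have "((\<lambda>x. inverse x ^ n / exp (inverse x)) \<longlongrightarrow> (0::real)) (at_right 0)"
    using filterlim_compose[OF tendsto_power_div_exp_0 filterlim_inverse_at_top_right] .
  then have "((\<lambda>x. flat_exp n x) \<longlongrightarrow> 0) (at_right 0)"
    by (rule Lim_transform_eventually)
       (auto simp: flat_exp_def exp_minus field_simps eventually_at_right_field intro: exI[of _ 1])
  moreover have "((\<lambda>x. flat_exp n x) \<longlongrightarrow> 0) (at_left 0)"
    by (rule tendsto_eventually) (auto simp: flat_exp_def eventually_at_left_field intro: exI[of _ "-1"])
  ultimately show ?thesis
    by (simp add: filterlim_at_split)
qed

lemma flat_exp_deriv:
  "(flat_exp n has_real_derivative (flat_exp (n + 2) x - real n * flat_exp (n + 1) x)) (at x)"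
proof (cases x "0::real" rule: linorder_cases)
  case less
  have "((\<lambda>x. 0) has_real_derivative 0) (at x)" by simp
  then have "(flat_exp n has_real_derivative 0) (at x)"
    by (rule has_field_derivative_transform_within_open[where S = "{..<0}"])
       (use less in \<open>auto simp: flat_exp_def\<close>)
  then show ?thesis using less by (simp add: flat_exp_def)
next
  case equal
  \<comment> \<open>The difference quotient of \<open>flat_exp n\<close> at 0 is exactly
    \<open>flat_exp (n + 1)\<close>.\<close>
  have "((\<lambda>h. flat_exp (n + 1) h) \<longlongrightarrow> 0) (at 0)"
    by (rule flat_exp_tendsto_0)
  then have "((\<lambda>h. (flat_exp n (0 + h) - flat_exp n 0) / h) \<longlongrightarrow> 0) (at 0)"
    by (rule Lim_transform_eventually)
       (auto simp: flat_exp_def field_simps intro!: always_eventually)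
  then show ?thesis using equal by (simp add: DERIV_def flat_exp_def)
next
  case greater
  have "((\<lambda>x. inverse x ^ n * exp (- inverse x)) has_real_derivative
     (flat_exp (n + 2) x - real n * flat_exp (n + 1) x)) (at x)"
  proof -
    have i: "(inverse has_real_derivative - (inverse x * inverse x)) (at x)"
      using DERIV_inverse[of x UNIV] greater by (simp add: power2_eq_square)
    have "((\<lambda>x. inverse x ^ n * exp (- inverse x)) has_real_derivative
      real n * (- (inverse x * inverse x) * inverse x ^ (n - 1)) * exp (- inverse x)
      + exp (- inverse x) * - (- (inverse x * inverse x)) * inverse x ^ n) (at x)"
      using DERIV_mult[OF DERIV_power[OF i, of n] DERIV_chain2[OF DERIV_exp DERIV_minus[OF i]]] by simp
    moreover have "real n * (- (inverse x * inverse x) * inverse x ^ (n - 1)) * exp (- inverse x)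
        + exp (- inverse x) * - (- (inverse x * inverse x)) * inverse x ^ n
      = flat_exp (n + 2) x - real n * flat_exp (n + 1) x"
      using greater by (cases n) (simp_all add: flat_exp_def algebra_simps)
    ultimately show ?thesis
      by (simp only:)
  qed
  then show ?thesis
    by (rule has_field_derivative_transform_within_open[where S = "{0<..}"])
       (use greater in \<open>auto simp: flat_exp_def\<close>)
qed

lemma Ck_on_flat_exp: "Ck_on k UNIV (flat_exp n)"
proof (induction k arbitrary: n)
  case 0
  show ?case
    using DERIV_isCont[OF flat_exp_deriv] by (simp add: continuous_at_imp_continuous_on)
next
  case (Suc k)
  show ?case
  proof (rule Ck_on_SucI)
    show "(flat_exp n has_derivative (\<lambda>v. (flat_exp (n + 2) x + (- real n) * flat_exp (n + 1) x) * v)) (at x)" for x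
      using flat_exp_deriv[of n x] by (simp add: has_field_derivative_def)
    show "Ck_on k UNIV (\<lambda>x. (flat_exp (n + 2) x + (- real n) * flat_exp (n + 1) x) * v)" for v
      by (intro Ck_on_mult Ck_on_add Ck_on_const Suc) auto
  qed simp
qed

text \<open>The usual quotient of bump functions: \<open>p\<close> changes sign at 1/3 and
  \<open>q\<close> at 2/3, so at every \<open>t\<close> one of \<open>e (p t)\<close> and
  \<open>e (q t)\<close> is positive and the denominator never vanishes. To the left of 1/3 only the
  second survives, to the right of 2/3 only the first.\<close>

lemma smooth_step:
  obtains h h' :: "real \<Rightarrow> real"
  where "\<And>k. Ck_on k UNIV h" "\<And>t. (h has_real_derivative h' t) (at t)" "\<And>t. 0 \<le> h' t"
    "\<And>t. 0 \<le> h t" "\<And>t. h t \<le> 1" "\<And>t. t \<le> 1/3 \<Longrightarrow> h t = 0" "\<And>t. t \<ge> 2/3 \<Longrightarrow> h t = 1"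
proof -
  define e where "e = flat_exp 0"
  define p where "p t = 3 * t - 1" for t :: real
  define q where "q t = 2 - 3 * t" for t :: real
  define d where "d t = e (p t) + e (q t)" for t
  define h where "h t = e (p t) * inverse (d t)" for t
  have e0: "e t \<ge> 0" "e t > 0 \<longleftrightarrow> t > 0" "e t = 0 \<longleftrightarrow> t \<le> 0" for t
    by (auto simp: e_def flat_exp_def)
  have dpos: "d t > 0" for t
    using e0[of "p t"] e0[of "q t"] by (cases "t > 1/3") (auto simp: d_def p_def q_def add_pos_nonneg add_nonneg_pos)
  have smp: "Ck_on k UNIV p" for k
    using Ck_on_add[OF open_UNIV Ck_on_mult[OF open_UNIV Ck_on_const[of _ _ 3] Ck_on_ident[OF open_UNIV]] Ck_on_const[of _ _ "-1"]]
    by (simp add: p_def[abs_def])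
  have smq: "Ck_on k UNIV q" for k
    using Ck_on_add[OF open_UNIV Ck_on_mult[OF open_UNIV Ck_on_const[of _ _ "-3"] Ck_on_ident[OF open_UNIV]] Ck_on_const[of _ _ "2"]]
    by (simp add: q_def[abs_def] algebra_simps)
  have sme: "Ck_on k UNIV e" for k
    using Ck_on_flat_exp by (simp add: e_def)
  have smep: "Ck_on k UNIV (\<lambda>t. e (p t))" "Ck_on k UNIV (\<lambda>t. e (q t))" for k
    using Ck_on_compose[OF open_UNIV open_UNIV _ smp sme] Ck_on_compose[OF open_UNIV open_UNIV _ smq sme] by auto
  have smd: "Ck_on k UNIV d" for k
    unfolding d_def[abs_def] by (intro Ck_on_add smep open_UNIV)
  have smh: "Ck_on k UNIV h" for k
    unfolding h_def[abs_def] using dpos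
    by (intro Ck_on_mult Ck_on_inverse smep smd open_UNIV) (auto simp: less_le)
  have de: "(e has_real_derivative flat_exp 2 t) (at t)" for t
    using flat_exp_deriv[of 0 t] by (simp add: e_def numeral_2_eq_2)
  have dp: "(p has_real_derivative 3) (at t)" and dq: "(q has_real_derivative (-3)) (at t)" for t
    unfolding p_def[abs_def] q_def[abs_def] by (auto intro!: derivative_eq_intros)
  have dep: "((\<lambda>t. e (p t)) has_real_derivative (flat_exp 2 (p t) * 3)) (at t)"
    and deq: "((\<lambda>t. e (q t)) has_real_derivative (flat_exp 2 (q t) * (-3))) (at t)" for t
    using DERIV_chain2[OF de dp] DERIV_chain2[OF de dq] by auto
  have f2: "flat_exp 2 t \<ge> 0" for t by (simp add: flat_exp_def)
  \<comment> \<open>In the quotient rule the terms containing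
    \<open>flat_exp 2 (p t) * e (p t)\<close> cancel; a sum of nonnegative products is left, so
    \<open>h\<close> is increasing.\<close>
  have dh: "(h has_real_derivative
      3 * (flat_exp 2 (p t) * e (q t) + e (p t) * flat_exp 2 (q t)) / (d t)\<^sup>2) (at t)" for t
  proof -
    have dn: "e (p t) + e (q t) \<noteq> 0" using dpos[of t] by (simp add: d_def)
    have "((\<lambda>t. e (p t) / (e (p t) + e (q t))) has_real_derivative
       ((flat_exp 2 (p t) * 3) * (e (p t) + e (q t)) - e (p t) * (flat_exp 2 (p t) * 3 + flat_exp 2 (q t) * (-3))) /
       ((e (p t) + e (q t)) * (e (p t) + e (q t)))) (at t)"
      by (rule DERIV_divide[OF dep DERIV_add[OF dep deq] dn])
    moreover have "h = (\<lambda>t. e (p t) / (e (p t) + e (q t)))"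
      by (simp add: h_def d_def fun_eq_iff divide_inverse)
    moreover have "(flat_exp 2 (p t) * 3) * (e (p t) + e (q t)) - e (p t) * (flat_exp 2 (p t) * 3 + flat_exp 2 (q t) * (-3))
      = 3 * (flat_exp 2 (p t) * e (q t) + e (p t) * flat_exp 2 (q t))"
      by (simp add: algebra_simps)
    ultimately show ?thesis
      by (simp only: d_def power2_eq_square)
  qed
  show ?thesis
  proof (rule that[OF smh dh])
    fix t :: real
    show "0 \<le> 3 * (flat_exp 2 (p t) * e (q t) + e (p t) * flat_exp 2 (q t)) / (d t)\<^sup>2"
      using e0 f2 by simp
    show "0 \<le> h t" using e0 dpos[of t] by (simp add: h_def)
    show "h t \<le> 1"
      using dpos[of t] e0(1)[of "q t"] unfolding h_def
      by (simp add: d_def divide_inverse[symmetric])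
    show "h t = 0" if "t \<le> 1/3"
      using that e0(3)[of "p t"] by (simp add: h_def p_def)
    show "h t = 1" if "t \<ge> 2/3"
      using that e0(3)[of "q t"] dpos[of t] by (simp add: h_def d_def q_def)
  qed
qed

section \<open>Charts, metric tensor and speed\<close>

lemma smooth_on_open:
  assumes "open S" "smooth_on S f" "x \<in> S"
  obtains U where "open U" "x \<in> U" "U \<subseteq> S" "\<And>k. Ck_on k U f"
proof -
  obtain V F where V: "open V" "x \<in> V" "\<And>k. Ck_on k V F" "\<And>y. y \<in> S \<inter> V \<Longrightarrow> F y = f y"
    using assms(2,3) unfolding smooth_on_def by metis
  show ?thesis
  proof (rule that[of "S \<inter> V"])
    show o: "open (S \<inter> V)" using assms(1) V(1) by blast
    show "Ck_on k (S \<inter> V) f" for k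
      by (rule Ck_on_cong[OF o V(4) Ck_on_subset[OF V(3)]]) auto
  qed (use assms V in auto)
qed

lemma Ck_on_has_vector_derivative:
  fixes F :: "real \<Rightarrow> 'b::real_normed_vector"
  assumes "Ck_on (Suc 0) U F" "t \<in> U"
  shows "(F has_vector_derivative vector_derivative F (at t)) (at t)"
  using assms differentiableI_vector vector_derivative_works
  by (metis Ck_on_Suc_has_derivative differentiable_def)

lemma Ck_on_continuous_vector_derivative:
  fixes F :: "real \<Rightarrow> 'b::real_normed_vector"
  assumes "Ck_on (Suc 0) U F"
  shows "continuous_on U (\<lambda>t. vector_derivative F (at t))"
proof -
  have "vector_derivative F (at t) = frechet_derivative F (at t) 1" if "t \<in> U" for t
    using assms that by (simp add: frechet_derivative_eq_vector_derivative)
  then show ?thesis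
    using assms by (simp cong: continuous_on_cong)
qed

locale riemannian_surface =
  fixes A :: "'a::{t2_space,second_countable_topology} chart set"
    and g :: "'a metric_tensor"
  assumes atlas: "smooth_atlas A" and metric: "riemannian_metric A g"
begin

abbreviation cinv :: "'a chart \<Rightarrow> real^2 \<Rightarrow> 'a" where
  "cinv c \<equiv> inv_into (fst c) (snd c)"

lemma chart:
  assumes "c \<in> A"
  shows "open (fst c)" "open (snd c ` fst c)"
    "homeomorphism (fst c) (snd c ` fst c) (snd c) (cinv c)"
  using atlas assms unfolding smooth_atlas_def case_prod_beta by blast+

lemma chart_continuous:
  assumes "c \<in> A"
  shows "continuous_on (fst c) (snd c)" "continuous_on (snd c ` fst c) (cinv c)"
  using chart(3)[OF assms] by (auto simp: homeomorphism_def)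

lemma cinv_left [simp]: "c \<in> A \<Longrightarrow> p \<in> fst c \<Longrightarrow> cinv c (snd c p) = p"
  using chart(3) by (auto simp: homeomorphism_def)

lemma cinv_right: "x \<in> snd c ` fst c \<Longrightarrow> snd c (cinv c x) = x"
  by (rule f_inv_into_f)

lemma cinv_in: "x \<in> snd c ` fst c \<Longrightarrow> cinv c x \<in> fst c"
  by (rule inv_into_into)

lemma ex_chart: obtains c where "c \<in> A" "p \<in> fst c"
  using atlas unfolding smooth_atlas_def by blast

lemma chart_at: "chart_at A p \<in> A" "p \<in> fst (chart_at A p)"
proof -
  have "\<exists>c. c \<in> A \<and> p \<in> fst c" using ex_chart by metis
  from someI_ex[OF this] show "chart_at A p \<in> A" "p \<in> fst (chart_at A p)"
    by (auto simp: chart_at_def)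
qed

lemma open_chart_preimage:
  assumes "c \<in> A" "open W"
  shows "open {p \<in> fst c. snd c p \<in> W}"
  using continuous_open_preimage[OF chart_continuous(1)[OF assms(1)] chart(1)[OF assms(1)] assms(2)]
  by (simp add: vimage_def Int_def)

lemma open_cinv_image:
  assumes "c \<in> A" "open W"
  shows "open {x \<in> snd c ` fst c. cinv c x \<in> W}"
  using continuous_open_preimage[OF chart_continuous(2)[OF assms(1)] chart(2)[OF assms(1)] assms(2)]
  by (simp add: vimage_def Int_def)

lemma chart_image_Int:
  assumes "c \<in> A"
  shows "snd c ` (fst c \<inter> W) = {x \<in> snd c ` fst c. cinv c x \<in> W}"
  using assms by force

lemma transition_smooth:
  assumes "c \<in> A" "d \<in> A" "p \<in> fst c" "p \<in> fst d"
  obtains U where "open U" "snd c p \<in> U" "U \<subseteq> snd c ` (fst c \<inter> fst d)"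
    "\<And>k. Ck_on k U (transition c d)"
proof -
  have "open (snd c ` (fst c \<inter> fst d))"
    using open_cinv_image[OF assms(1) chart(1)[OF assms(2)]]
    by (simp add: chart_image_Int[OF assms(1)])
  moreover have "smooth_on (snd c ` (fst c \<inter> fst d)) (transition c d)"
    using atlas assms unfolding smooth_atlas_def by blast
  ultimately show ?thesis
    by (rule smooth_on_open[where x = "snd c p"]) (use assms that in auto)
qed

section \<open>The metric tensor in coordinates\<close>

lemma metric_point:
  assumes "c \<in> A" "p \<in> fst c"
  shows "bilinear (g c p)" "v \<noteq> 0 \<Longrightarrow> 0 < g c p v v"
  using metric assms unfolding riemannian_metric_def by auto

lemma metric_nonneg: "c \<in> A \<Longrightarrow> p \<in> fst c \<Longrightarrow> 0 \<le> g c p v v"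
  using metric_point(2)[of c p v] metric_point(1)[of c p] bilinear_lzero[of "g c p" v]
  by (cases "v = 0") auto

lemma metric_scale:
  assumes "c \<in> A" "p \<in> fst c"
  shows "g c p (a *\<^sub>R v) (a *\<^sub>R v) = a\<^sup>2 * g c p v v"
  using metric_point(1)[OF assms] by (simp add: bilinear_lmul bilinear_rmul power2_eq_square)

lemma metric_transition:
  assumes "c \<in> A" "d \<in> A" "p \<in> fst c" "p \<in> fst d"
  shows "g d p (frechet_derivative (transition c d) (at (snd c p)) v)
              (frechet_derivative (transition c d) (at (snd c p)) w) = g c p v w"
  using metric assms unfolding riemannian_metric_def by blast

lemma metric_coeff_continuous:
  assumes "c \<in> A"
  shows "continuous_on (snd c ` fst c) (\<lambda>x. g c (cinv c x) v w)"
proof (rule continuous_at_imp_continuous_on, rule ballI)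
  fix x assume x: "x \<in> snd c ` fst c"
  have s: "smooth_on (snd c ` fst c) (\<lambda>x. g c (cinv c x) v w)"
    using metric assms unfolding riemannian_metric_def by blast
  obtain U where "open U" "x \<in> U" "U \<subseteq> snd c ` fst c" "\<And>k. Ck_on k U (\<lambda>x. g c (cinv c x) v w)"
    using smooth_on_open[OF chart(2)[OF assms] s x] by metis
  then show "isCont (\<lambda>x. g c (cinv c x) v w) x"
    using Ck_on_continuous[of 0] continuous_on_eq_continuous_at by blast
qed

text \<open>Smoothness of the metric is given for fixed vectors only. Expanding in coordinates
  yields continuity when the base point and the vector vary together.\<close>

lemma metric_expand:
  assumes "c \<in> A" "p \<in> fst c"
  shows "g c p v v = (\<Sum>(i,j)\<in>Basis \<times> Basis. (v \<bullet> i) * ((v \<bullet> j) * g c p i j))"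
proof -
  have "g c p v v = g c p (\<Sum>i\<in>Basis. (v \<bullet> i) *\<^sub>R i) (\<Sum>j\<in>Basis. (v \<bullet> j) *\<^sub>R j)"
    by (simp add: euclidean_representation)
  also have "\<dots> = (\<Sum>(i,j)\<in>Basis \<times> Basis. g c p ((v \<bullet> i) *\<^sub>R i) ((v \<bullet> j) *\<^sub>R j))"
    by (rule bilinear_sum[OF metric_point(1)[OF assms]])
  also have "\<dots> = (\<Sum>(i,j)\<in>Basis \<times> Basis. (v \<bullet> i) * ((v \<bullet> j) * g c p i j))"
    using metric_point(1)[OF assms]
    by (intro sum.cong) (auto simp: bilinear_lmul bilinear_rmul)
  finally show ?thesis .
qed

lemma metric_continuous:
  assumes "c \<in> A" "continuous_on T F" "continuous_on T V" "F ` T \<subseteq> snd c ` fst c"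
  shows "continuous_on T (\<lambda>t. g c (cinv c (F t)) (V t) (V t))"
proof -
  have "continuous_on T (\<lambda>t. \<Sum>(i,j)\<in>Basis \<times> Basis. (V t \<bullet> i) * ((V t \<bullet> j) * g c (cinv c (F t)) i j))"
    using assms(3) continuous_on_compose2[OF metric_coeff_continuous[OF assms(1)] assms(2,4)]
    by (intro continuous_on_sum) (auto intro!: continuous_intros simp: split_beta)
  moreover have "g c (cinv c (F t)) (V t) (V t)
      = (\<Sum>(i,j)\<in>Basis \<times> Basis. (V t \<bullet> i) * ((V t \<bullet> j) * g c (cinv c (F t)) i j))" if "t \<in> T" for t
  proof (rule metric_expand[OF assms(1)])
    show "cinv c (F t) \<in> fst c" using assms(4) that by (intro cinv_in) blast
  qed
  ultimately show ?thesis
    by (simp cong: continuous_on_cong)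
qed

text \<open>Extreme values on the compact product of \<open>K\<close> with the unit circle, extended
  to all vectors by homogeneity. The lower bound makes it costly to leave a disc, the upper bound
  makes small circles short.\<close>

lemma metric_bounds:
  assumes "c \<in> A" "compact K" "K \<subseteq> snd c ` fst c"
  obtains m M where "0 < m" "0 < M"
    "\<And>x v. x \<in> K \<Longrightarrow> m * norm v \<le> sqrt (g c (cinv c x) v v)"
    "\<And>x v. x \<in> K \<Longrightarrow> sqrt (g c (cinv c x) v v) \<le> M * norm v"
proof (cases "K = {}")
  case True
  then show ?thesis using that[of 1 1] by simp
next
  case False
  let ?S = "K \<times> sphere (0::real^2) 1"
  let ?q = "\<lambda>z. sqrt (g c (cinv c (fst z)) (snd z) (snd z))"
  have comp: "compact ?S" using assms(2) by (intro compact_Times) auto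
  have "axis 1 1 \<in> sphere (0::real^2) 1" by simp
  then have ne: "?S \<noteq> {}" using False by blast
  have cont: "continuous_on ?S ?q"
    by (intro continuous_on_real_sqrt metric_continuous[OF assms(1)] continuous_intros)
       (use assms(3) in auto)
  have pos: "0 < ?q z" if "z \<in> ?S" for z
  proof -
    have "fst z \<in> snd c ` fst c" "snd z \<noteq> 0"
      using that assms(3) by auto
    then have "cinv c (fst z) \<in> fst c" "snd z \<noteq> 0"
      using cinv_in by auto
    then show ?thesis using metric_point(2)[OF assms(1)] by simp
  qed
  obtain z0 where z0: "z0 \<in> ?S" "\<And>z. z \<in> ?S \<Longrightarrow> ?q z0 \<le> ?q z"
    using continuous_attains_inf[OF comp ne cont] by blast
  obtain z1 where z1: "z1 \<in> ?S" "\<And>z. z \<in> ?S \<Longrightarrow> ?q z \<le> ?q z1"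
    using continuous_attains_sup[OF comp ne cont] by blast
  have scale: "sqrt (g c (cinv c x) v v) = norm v * ?q (x, v /\<^sub>R norm v)" if "x \<in> K" "v \<noteq> 0" for x v
  proof -
    have p: "cinv c x \<in> fst c" using that assms(3) by (intro cinv_in) blast
    have "g c (cinv c x) v v = (norm v)\<^sup>2 * g c (cinv c x) (v /\<^sub>R norm v) (v /\<^sub>R norm v)"
      using metric_scale[OF assms(1) p, of "norm v" "v /\<^sub>R norm v"] that by simp
    then show ?thesis by (simp add: real_sqrt_mult)
  qed
  have zero: "g c (cinv c x) 0 0 = 0" if "x \<in> K" for x
  proof -
    have "cinv c x \<in> fst c" using that assms(3) by (intro cinv_in) blast
    then show ?thesis using bilinear_lzero[OF metric_point(1)[OF assms(1)]] by blast
  qed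
  show ?thesis
  proof (rule that[of "?q z0" "?q z1"])
    show "0 < ?q z0" "0 < ?q z1" using pos z0 z1 by auto
    fix x and v :: "real^2" assume x: "x \<in> K"
    show "?q z0 * norm v \<le> sqrt (g c (cinv c x) v v)"
    proof (cases "v = 0")
      case False
      have "?q z0 \<le> ?q (x, v /\<^sub>R norm v)" using x False by (intro z0(2)) auto
      then show ?thesis unfolding scale[OF x False]
        by (subst mult.commute) (rule mult_left_mono, auto)
    qed (use zero[OF x] in simp)
    show "sqrt (g c (cinv c x) v v) \<le> ?q z1 * norm v"
    proof (cases "v = 0")
      case False
      have "?q (x, v /\<^sub>R norm v) \<le> ?q z1" using x False by (intro z1(2)) auto
      then show ?thesis unfolding scale[OF x False]
        by (subst mult.commute[of "?q z1"]) (rule mult_left_mono, auto)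
    qed (use zero[OF x] in simp)
  qed
qed

text \<open>The coordinate expression \<open>F\<close> is smooth on an open set of the line that may
  reach beyond \<open>{0..1}\<close>, so that two-sided derivatives are available even at the end
  points of the path.\<close>

definition local_rep :: "'a chart \<Rightarrow> real set \<Rightarrow> (real \<Rightarrow> real^2) \<Rightarrow> (real \<Rightarrow> 'a) \<Rightarrow> bool" where
  "local_rep c U F \<gamma> \<longleftrightarrow> c \<in> A \<and> open U \<and> (\<forall>k. Ck_on k U F) \<and>
     (\<forall>s\<in>U \<inter> {0..1}. \<gamma> s \<in> fst c \<and> snd c (\<gamma> s) = F s)"

lemma local_repD:
  assumes "local_rep c U F \<gamma>"
  shows "c \<in> A" "open U" "Ck_on k U F" "s \<in> U \<Longrightarrow> s \<in> {0..1} \<Longrightarrow> \<gamma> s \<in> fst c"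
    "s \<in> U \<Longrightarrow> s \<in> {0..1} \<Longrightarrow> snd c (\<gamma> s) = F s"
  using assms by (auto simp: local_rep_def)

text \<open>The extension that \<open>smooth_on\<close> provides agrees with the coordinates only at
  times when the path is in the chart; continuity of the path gives the open set \<open>T\<close> of
  times to which it must be restricted.\<close>

lemma smooth_path_local_rep:
  assumes "smooth_path A \<gamma>" "t \<in> {0..1}" "c \<in> A" "\<gamma> t \<in> fst c"
  obtains U F where "t \<in> U" "local_rep c U F \<gamma>"
proof -
  have "continuous_on {0..1} \<gamma>"
    using assms(1) by (simp add: smooth_path_def path_def)
  then have "openin (top_of_set {0..1}) ({0..1} \<inter> \<gamma> -` fst c)"
    using chart(1)[OF assms(3)] continuous_openin_preimage_gen by blast
  then obtain T where T: "open T" "{0..1} \<inter> \<gamma> -` fst c = {0..1} \<inter> T"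
    by (auto simp: openin_open)
  have "smooth_on {t\<in>{0..1}. \<gamma> t \<in> fst c} (snd c \<circ> \<gamma>)"
    using assms(1,3) by (simp add: smooth_path_def)
  then obtain V F where V: "open V" "t \<in> V" "\<And>k. Ck_on k V F"
      "\<And>y. y \<in> {t\<in>{0..1}. \<gamma> t \<in> fst c} \<inter> V \<Longrightarrow> F y = (snd c \<circ> \<gamma>) y"
    using assms(2,4) unfolding smooth_on_def by (metis (mono_tags, lifting) mem_Collect_eq)
  have "t \<in> T" using assms(2,4) T(2) by blast
  moreover have "local_rep c (T \<inter> V) F \<gamma>"
    unfolding local_rep_def
  proof (intro conjI allI ballI)
    show "Ck_on k (T \<inter> V) F" for k by (rule Ck_on_subset[OF V(3)]) auto
    fix s assume s: "s \<in> T \<inter> V \<inter> {0..1}"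
    then show "\<gamma> s \<in> fst c" using T(2) by blast
    then show "snd c (\<gamma> s) = F s" using V(4)[of s] s by simp
  qed (use assms T V in auto)
  ultimately show ?thesis using V(2) that by blast
qed

lemma local_rep_continuous:
  assumes "local_rep c U F \<gamma>" "t \<in> U" "t \<in> {0..1}"
  shows "continuous (at t within {0..1}) \<gamma>"
proof -
  note r = local_repD[OF assms(1)]
  have img: "F s \<in> snd c ` fst c" "cinv c (F s) = \<gamma> s" if "s \<in> U \<inter> {0..1}" for s
  proof -
    have "\<gamma> s \<in> fst c" "F s = snd c (\<gamma> s)" using r(4,5) that by auto
    then show "F s \<in> snd c ` fst c" "cinv c (F s) = \<gamma> s" using r(1) by auto
  qed
  have "continuous_on (U \<inter> {0..1}) (\<lambda>s. cinv c (F s))"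
  proof (rule continuous_on_compose2[OF chart_continuous(2)[OF r(1)]])
    show "continuous_on (U \<inter> {0..1}) F"
      by (rule continuous_on_subset[OF Ck_on_continuous[OF r(3)]]) auto
    show "F ` (U \<inter> {0..1}) \<subseteq> snd c ` fst c"
      using img(1) by blast
  qed
  then have "continuous_on (U \<inter> {0..1}) \<gamma>"
    by (rule continuous_on_eq) (rule img(2))
  then have "continuous (at t within U \<inter> {0..1}) \<gamma>"
    using assms by (auto simp: continuous_on_eq_continuous_within)
  moreover have "at t within U \<inter> {0..1} = at t within {0..1}"
    by (rule at_within_nhd[OF assms(2) r(2)]) auto
  ultimately show ?thesis by simp
qed

text \<open>One chart around each parameter is enough: composing with a smooth transition map gives
  the coordinate expression in every other chart.\<close>

lemma smooth_pathI:
  assumes "\<And>t. t \<in> {0..1} \<Longrightarrow> \<exists>c U F. t \<in> U \<and> local_rep c U F \<gamma>"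
  shows "smooth_path A \<gamma>"
  unfolding smooth_path_def smooth_on_def
proof (intro conjI ballI)
  show "path \<gamma>"
    unfolding path_def continuous_on_eq_continuous_within
    using assms local_rep_continuous by blast
  fix d t assume d: "d \<in> A" and t: "t \<in> {t \<in> {0..1}. \<gamma> t \<in> fst d}"
  then obtain c U F where r: "t \<in> U" "local_rep c U F \<gamma>" using assms by blast
  note r' = local_repD[OF r(2)]
  have tc: "\<gamma> t \<in> fst c" "snd c (\<gamma> t) = F t" using r' r(1) t by auto
  obtain W where W: "open W" "snd c (\<gamma> t) \<in> W" "W \<subseteq> snd c ` (fst c \<inter> fst d)"
      "\<And>k. Ck_on k W (transition c d)"
    using transition_smooth[OF r'(1) d tc(1)] t by blast
  define V where "V = U \<inter> F -` W"
  have "open V"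
    unfolding V_def using r'(3)[of 0] by (intro continuous_open_preimage r' W) simp
  moreover have "t \<in> V" using W tc r(1) by (simp add: V_def)
  moreover have "Ck_on k V (\<lambda>s. transition c d (F s))" for k
    by (rule Ck_on_compose[OF \<open>open V\<close> W(1) _ Ck_on_subset[OF r'(3)] W(4)]) (auto simp: V_def)
  moreover have "transition c d (F s) = (snd d \<circ> \<gamma>) s"
    if "s \<in> {t \<in> {0..1}. \<gamma> t \<in> fst d} \<inter> V" for s
  proof -
    have "s \<in> U" "s \<in> {0..1}" using that by (auto simp: V_def)
    then have "\<gamma> s \<in> fst c" "snd c (\<gamma> s) = F s" using r' by auto
    then show ?thesis using r'(1) by (simp add: transition_def flip: \<open>snd c (\<gamma> s) = F s\<close>)
  qed
  ultimately show "\<exists>U F. open U \<and> t \<in> U \<and> (\<forall>k. Ck_on k U F) \<and>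
      (\<forall>y\<in>{t \<in> {0..1}. \<gamma> t \<in> fst d} \<inter> U. F y = (snd d \<circ> \<gamma>) y)"
    by blast
qed

text \<open>\<open>speed\<close> refers to an arbitrarily chosen chart. The chain rule for the
  transition map and the invariance of the metric under its derivative allow any other chart, and a
  two-sided derivative, to be used instead.\<close>

lemma speed_local_rep:
  assumes "local_rep c U F \<gamma>" "t \<in> U" "t \<in> {0..1}"
    and v: "(F has_vector_derivative v) (at t)"
  shows "speed A g \<gamma> t = sqrt (g c (\<gamma> t) v v)"
proof -
  note r = local_repD[OF assms(1)]
  define d where "d = chart_at A (\<gamma> t)"
  have d: "d \<in> A" "\<gamma> t \<in> fst d" using chart_at by (auto simp: d_def)
  have tc: "\<gamma> t \<in> fst c" "snd c (\<gamma> t) = F t" using r assms by auto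
  obtain W where W: "open W" "snd c (\<gamma> t) \<in> W" "W \<subseteq> snd c ` (fst c \<inter> fst d)"
      "\<And>k. Ck_on k W (transition c d)"
    using transition_smooth[OF r(1) d(1) tc(1) d(2)] by metis
  let ?T' = "frechet_derivative (transition c d) (at (F t))"
  have T: "(transition c d has_derivative ?T') (at (F t))"
    using Ck_on_Suc_has_derivative[OF W(4)[of "Suc 0"]] W(2) tc(2) by simp
  have "((\<lambda>s. transition c d (F s)) has_vector_derivative ?T' v) (at t within {0..1})"
    using vector_derivative_diff_chain_within[OF has_vector_derivative_at_within[OF v]
        has_derivative_at_withinI[OF T]] by (simp add: o_def)
  moreover obtain e where "e > 0" "\<And>s. dist s t < e \<Longrightarrow> s \<in> U"
    using r(2) assms(2) by (metis open_dist)
  ultimately have "((snd d \<circ> \<gamma>) has_vector_derivative ?T' v) (at t within {0..1})"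
  proof (elim has_vector_derivative_transform_within)
    fix s assume s: "s \<in> {0..1::real}" "dist s t < e"
    then have "s \<in> U" using \<open>\<And>s. dist s t < e \<Longrightarrow> s \<in> U\<close> by blast
    then have "\<gamma> s \<in> fst c" "snd c (\<gamma> s) = F s" using r s by auto
    then show "transition c d (F s) = (snd d \<circ> \<gamma>) s"
      using r(1) by (simp add: transition_def flip: \<open>snd c (\<gamma> s) = F s\<close>)
  qed (use assms in auto)
  then have "vector_derivative (snd d \<circ> \<gamma>) (at t within {0..1}) = ?T' v"
    using vector_derivative_within_closed_interval[of 0 1] assms(3) by simp
  then show ?thesis
    using metric_transition[OF r(1) d(1) tc(1) d(2), of v v] tc(2)
    by (simp add: speed_def d_def Let_def)
qed

lemma speed_local_rep':
  assumes "local_rep c U F \<gamma>" "t \<in> U" "t \<in> {0..1}"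
  shows "speed A g \<gamma> t = sqrt (g c (\<gamma> t) (vector_derivative F (at t)) (vector_derivative F (at t)))"
  using speed_local_rep[OF assms Ck_on_has_vector_derivative[OF local_repD(3)[OF assms(1)] assms(2)]] .

lemma speed_nonneg: "0 \<le> speed A g \<gamma> t"
  using metric_nonneg[OF chart_at] by (simp add: speed_def Let_def)

lemma path_length_nonneg: "0 \<le> path_length A g \<gamma>"
  unfolding path_length_def
  \<comment> \<open>The path need not be smooth here; the integral of a non-integrable function is 0
    by convention.\<close>
  by (cases "speed A g \<gamma> integrable_on {0..1}")
     (auto intro: Henstock_Kurzweil_Integration.integral_nonneg speed_nonneg simp: not_integrable_integral)

end

section \<open>Length and the inner distance\<close>

context riemannian_surface
begin

lemma speed_continuous:
  assumes "smooth_path A \<gamma>"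
  shows "continuous_on {0..1} (speed A g \<gamma>)"
  unfolding continuous_on_eq_continuous_within
proof
  fix t :: real assume t: "t \<in> {0..1}"
  obtain c where c: "c \<in> A" "\<gamma> t \<in> fst c" by (rule ex_chart)
  obtain U F where U: "t \<in> U" and lr: "local_rep c U F \<gamma>"
    using smooth_path_local_rep[OF assms t c] by blast
  note r = local_repD[OF lr]
  let ?q = "\<lambda>s. sqrt (g c (cinv c (F s)) (vector_derivative F (at s)) (vector_derivative F (at s)))"
  have "continuous_on (U \<inter> {0..1}) ?q"
  proof (intro continuous_on_real_sqrt metric_continuous[OF c(1)])
    show "continuous_on (U \<inter> {0..1}) F"
      by (rule continuous_on_subset[OF Ck_on_continuous[OF r(3)]]) auto
    show "continuous_on (U \<inter> {0..1}) (\<lambda>s. vector_derivative F (at s))"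
      by (rule continuous_on_subset[OF Ck_on_continuous_vector_derivative[OF r(3)]]) auto
    show "F ` (U \<inter> {0..1}) \<subseteq> snd c ` fst c"
    proof
      fix x assume "x \<in> F ` (U \<inter> {0..1})"
      then obtain s where s: "s \<in> U" "s \<in> {0..1}" "x = F s" by blast
      then show "x \<in> snd c ` fst c" using r(4)[OF s(1,2)] r(5)[OF s(1,2)] by (metis imageI)
    qed
  qed
  then have "continuous_on (U \<inter> {0..1}) (speed A g \<gamma>)"
  proof (rule continuous_on_eq)
    fix s assume s: "s \<in> U \<inter> {0..1}"
    then have "cinv c (F s) = \<gamma> s"
      using r(1) r(4)[of s] r(5)[of s] by (metis IntE cinv_left)
    then show "?q s = speed A g \<gamma> s"
      using speed_local_rep'[OF lr, of s] s by simp
  qed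
  then have "continuous (at t within U \<inter> {0..1}) (speed A g \<gamma>)"
    using t U by (auto simp: continuous_on_eq_continuous_within)
  moreover have "at t within U \<inter> {0..1} = at t within {0..1}"
    by (rule at_within_nhd[OF U r(2)]) auto
  ultimately show "continuous (at t within {0..1}) (speed A g \<gamma>)" by simp
qed

text \<open>An antiderivative of the speed, through which lengths of reparametrised and joined paths
  are computed by the fundamental theorem of calculus.\<close>

lemma arc_length_function:
  assumes "smooth_path A \<gamma>"
  obtains L where "continuous_on {0..1} L"
    "\<And>t. t \<in> {0..1} \<Longrightarrow> (L has_vector_derivative speed A g \<gamma> t) (at t within {0..1})"
    "L 0 = 0" "L 1 = path_length A g \<gamma>"
    "\<And>s t. 0 \<le> s \<Longrightarrow> s \<le> t \<Longrightarrow> t \<le> 1 \<Longrightarrow> L s \<le> L t"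
proof
  let ?L = "\<lambda>t. integral {0..t} (speed A g \<gamma>)"
  note cont = speed_continuous[OF assms]
  have int: "speed A g \<gamma> integrable_on {0..1}"
    by (rule integrable_continuous_real[OF cont])
  show "(?L has_vector_derivative speed A g \<gamma> t) (at t within {0..1})" if "t \<in> {0..1}" for t
    by (rule integral_has_vector_derivative[OF cont that])
  show "continuous_on {0..1} ?L" by (rule indefinite_integral_continuous_1[OF int])
  show "?L 0 = 0" "?L 1 = path_length A g \<gamma>" by (simp_all add: path_length_def)
  fix s t :: real assume "0 \<le> s" "s \<le> t" "t \<le> 1"
  then show "?L s \<le> ?L t"
    by (intro integral_subset_le integrable_on_subinterval[OF int]) (auto simp: speed_nonneg)
qed

lemma local_rep_reparam:
  assumes lr: "local_rep c U F \<gamma>" and sm: "\<And>k. Ck_on k UNIV \<tau>"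
    and V: "open V" "\<forall>s\<in>V \<inter> {0..1}. \<tau> s \<in> {0..1} \<and> \<delta> s = \<gamma> (\<tau> s)"
  shows "local_rep c (V \<inter> \<tau> -` U) (\<lambda>s. F (\<tau> s)) \<delta>"
proof -
  note r = local_repD[OF lr]
  have "open (\<tau> -` U)"
    using open_vimage[OF r(2) Ck_on_continuous[OF sm[of 0]]] .
  then have o: "open (V \<inter> \<tau> -` U)" using V(1) by blast
  show ?thesis
    unfolding local_rep_def
  proof (intro conjI allI ballI)
    show "Ck_on k (V \<inter> \<tau> -` U) (\<lambda>s. F (\<tau> s))" for k
      by (rule Ck_on_compose[OF o r(2) _ Ck_on_subset[OF sm] r(3)]) auto
    fix s assume s: "s \<in> V \<inter> \<tau> -` U \<inter> {0..1}"
    then have "\<tau> s \<in> U" "\<tau> s \<in> {0..1}" "\<delta> s = \<gamma> (\<tau> s)" using V(2) by auto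
    then show "\<delta> s \<in> fst c" "snd c (\<delta> s) = F (\<tau> s)" using r(4,5) by auto
  qed (use r(1) o in auto)
qed

text \<open>\<open>\<delta>\<close> has to agree with a reparametrisation of \<open>\<gamma>\<close>
  on \<open>V\<close> only; thus each half of a concatenation is covered, with \<open>V\<close> on
  one side of 1/2.\<close>

lemma speed_reparam:
  assumes sp: "smooth_path A \<gamma>" and sm: "\<And>k. Ck_on k UNIV \<tau>"
    and V: "open V" "\<forall>s\<in>V \<inter> {0..1}. \<tau> s \<in> {0..1} \<and> \<delta> s = \<gamma> (\<tau> s)"
    and d: "(\<tau> has_real_derivative \<tau>') (at t)" and t: "t \<in> V" "t \<in> {0..1}"
  shows "\<exists>c U F. t \<in> U \<and> local_rep c U F \<delta>"
    and "speed A g \<delta> t = \<bar>\<tau>'\<bar> * speed A g \<gamma> (\<tau> t)"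
proof -
  have tt: "\<tau> t \<in> {0..1}" "\<delta> t = \<gamma> (\<tau> t)" using V(2) t by auto
  obtain c where c: "c \<in> A" "\<gamma> (\<tau> t) \<in> fst c" by (rule ex_chart)
  obtain U F where U: "\<tau> t \<in> U" and lr: "local_rep c U F \<gamma>"
    using smooth_path_local_rep[OF sp tt(1) c] by blast
  note lr' = local_rep_reparam[OF lr sm V]
  show "\<exists>c U F. t \<in> U \<and> local_rep c U F \<delta>"
    by (rule exI[of _ c], rule exI[of _ "V \<inter> \<tau> -` U"], rule exI[of _ "\<lambda>s. F (\<tau> s)"])
       (use U t lr' in simp)
  note F = Ck_on_has_vector_derivative[OF local_repD(3)[OF lr] U]
  let ?v = "vector_derivative F (at (\<tau> t))"
  have "((\<lambda>s. F (\<tau> s)) has_vector_derivative \<tau>' *\<^sub>R ?v) (at t)"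
    using vector_diff_chain_at[OF d[unfolded has_real_derivative_iff_has_vector_derivative] F]
    by (simp add: o_def)
  from speed_local_rep[OF lr' _ t(2) this]
  have "speed A g \<delta> t = sqrt (g c (\<delta> t) (\<tau>' *\<^sub>R ?v) (\<tau>' *\<^sub>R ?v))"
    using t U by simp
  also have "\<dots> = \<bar>\<tau>'\<bar> * sqrt (g c (\<gamma> (\<tau> t)) ?v ?v)"
    using metric_scale[OF c] tt by (simp add: real_sqrt_mult)
  also have "\<dots> = \<bar>\<tau>'\<bar> * speed A g \<gamma> (\<tau> t)"
    using speed_local_rep'[OF lr U tt(1)] by simp
  finally show "speed A g \<delta> t = \<bar>\<tau>'\<bar> * speed A g \<gamma> (\<tau> t)" .
qed

text \<open>Up to the sign \<open>\<sigma>\<close> of \<open>\<tau>'\<close>, the function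
  \<open>L o \<tau>\<close> is an arc length function of the new path. Only an inequality results,
  as \<open>\<tau>\<close> need not reach 0 and 1; allowing \<open>\<tau>\<close> to decrease covers
  reversal.\<close>

lemma reparam:
  assumes sp: "smooth_path A \<gamma>" and sm: "\<And>k. Ck_on k UNIV \<tau>"
    and rng: "\<And>s. s \<in> {0..1} \<Longrightarrow> \<tau> s \<in> {0..1}"
    and d: "\<And>t. (\<tau> has_real_derivative \<tau>' t) (at t)"
    and sgn: "(\<forall>t. 0 \<le> \<tau>' t) \<or> (\<forall>t. \<tau>' t \<le> 0)"
  shows "smooth_path A (\<gamma> \<circ> \<tau>)" "path_length A g (\<gamma> \<circ> \<tau>) \<le> path_length A g \<gamma>"
proof -
  note sr = speed_reparam[OF sp sm open_UNIV, where \<delta> = "\<gamma> \<circ> \<tau>", OF _ d UNIV_I]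
  show sp': "smooth_path A (\<gamma> \<circ> \<tau>)"
    by (rule smooth_pathI, rule sr(1)) (use rng in auto)
  define \<sigma> :: real where "\<sigma> = (if \<forall>t. 0 \<le> \<tau>' t then 1 else -1)"
  have \<sigma>: "\<sigma> = 1 \<or> \<sigma> = -1" "\<bar>\<tau>' t\<bar> = \<sigma> * \<tau>' t" for t
    using sgn by (auto simp: \<sigma>_def)
  obtain L where L: "\<And>t. t \<in> {0..1} \<Longrightarrow> (L has_vector_derivative speed A g \<gamma> t) (at t within {0..1})"
    "L 0 = 0" "L 1 = path_length A g \<gamma>" "\<And>s t. 0 \<le> s \<Longrightarrow> s \<le> t \<Longrightarrow> t \<le> 1 \<Longrightarrow> L s \<le> L t"
    using arc_length_function[OF sp] by metis
  have "((\<lambda>t. \<sigma> * L (\<tau> t)) has_vector_derivative speed A g (\<gamma> \<circ> \<tau>) t) (at t within {0..1})"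
    if t: "t \<in> {0..1}" for t
  proof -
    have "(L has_vector_derivative speed A g \<gamma> (\<tau> t)) (at (\<tau> t) within \<tau> ` {0..1})"
      by (rule has_vector_derivative_within_subset[OF L(1)[OF rng[OF t]]]) (use rng in blast)
    from vector_diff_chain_within[OF has_vector_derivative_at_within[OF
          d[unfolded has_real_derivative_iff_has_vector_derivative]] this]
    have "((\<lambda>s. L (\<tau> s)) has_vector_derivative \<tau>' t * speed A g \<gamma> (\<tau> t)) (at t within {0..1})"
      by (simp add: o_def)
    from has_vector_derivative_mult_right[OF this, of \<sigma>]
    have "((\<lambda>s. \<sigma> * L (\<tau> s)) has_vector_derivative \<sigma> * (\<tau>' t * speed A g \<gamma> (\<tau> t))) (at t within {0..1})" .
    moreover have "speed A g (\<gamma> \<circ> \<tau>) t = \<sigma> * (\<tau>' t * speed A g \<gamma> (\<tau> t))"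
      using sr(2)[OF _ t] rng \<sigma>(2)[of t] by simp
    ultimately show ?thesis by (simp only:)
  qed
  then have "(speed A g (\<gamma> \<circ> \<tau>) has_integral \<sigma> * L (\<tau> 1) - \<sigma> * L (\<tau> 0)) {0..1}"
    by (intro fundamental_theorem_of_calculus) auto
  then have eq: "path_length A g (\<gamma> \<circ> \<tau>) = \<sigma> * L (\<tau> 1) - \<sigma> * L (\<tau> 0)"
    unfolding path_length_def by (rule integral_unique)
  have "0 \<le> L (\<tau> s) \<and> L (\<tau> s) \<le> L 1" if "s \<in> {0..1}" for s
    using L(2) L(4)[of 0 "\<tau> s"] L(4)[of "\<tau> s" 1] rng[OF that] by auto
  from this[of 0] this[of 1] show "path_length A g (\<gamma> \<circ> \<tau>) \<le> path_length A g \<gamma>"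
    unfolding eq L(3)[symmetric] using \<sigma>(1) by auto
qed

lemma flatten:
  assumes "smooth_path A \<gamma>"
  obtains \<delta> where "smooth_path A \<delta>" "path_length A g \<delta> \<le> path_length A g \<gamma>"
    "path_image \<delta> \<subseteq> path_image \<gamma>"
    "\<And>t. t \<le> 1/3 \<Longrightarrow> \<delta> t = \<gamma> 0" "\<And>t. t \<ge> 2/3 \<Longrightarrow> \<delta> t = \<gamma> 1"
proof -
  obtain h h' :: "real \<Rightarrow> real" where h: "\<And>k. Ck_on k UNIV h"
    "\<And>t. (h has_real_derivative h' t) (at t)" "\<And>t. 0 \<le> h' t"
    "\<And>t. 0 \<le> h t" "\<And>t. h t \<le> 1" "\<And>t. t \<le> 1/3 \<Longrightarrow> h t = 0" "\<And>t. t \<ge> 2/3 \<Longrightarrow> h t = 1"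
    using smooth_step by metis
  note r = reparam[OF assms h(1) _ h(2)]
  show ?thesis
    by (rule that[OF r]) (use h in \<open>auto simp: path_image_def\<close>)
qed

text \<open>The paths are constant near the junction, so that joining them preserves smoothness.\<close>

lemma join_flat:
  assumes sp: "smooth_path A \<gamma>" "smooth_path A \<delta>"
    and flat: "\<And>t. t \<ge> 2/3 \<Longrightarrow> \<gamma> t = p" "\<And>t. t \<le> 1/3 \<Longrightarrow> \<delta> t = p"
  shows "smooth_path A (\<gamma> +++ \<delta>)"
    "path_length A g (\<gamma> +++ \<delta>) = path_length A g \<gamma> + path_length A g \<delta>"
proof -
  \<comment> \<open>The summands \<open>0\<close> and \<open>-1\<close> put both parameter changes
    into the form \<open>b * x + a\<close> of \<open>Ck_on_affine\<close> and
    \<open>DERIV_affine\<close>.\<close>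
  have V1: "\<forall>s\<in>{..<1/2} \<inter> {0..1}. 2 * s + 0 \<in> {0..1} \<and> (\<gamma> +++ \<delta>) s = \<gamma> (2 * s + 0)"
    by (auto simp: joinpaths_def)
  have V2: "\<forall>s\<in>{1/2<..} \<inter> {0..1}. 2 * s + (-1) \<in> {0..1} \<and> (\<gamma> +++ \<delta>) s = \<delta> (2 * s + (-1))"
    by (auto simp: joinpaths_def)
  note sr1 = speed_reparam[OF sp(1) Ck_on_affine open_lessThan V1 DERIV_affine]
  note sr2 = speed_reparam[OF sp(2) Ck_on_affine open_greaterThan V2 DERIV_affine]
  show "smooth_path A (\<gamma> +++ \<delta>)"
  proof (rule smooth_pathI)
    fix t :: real assume t: "t \<in> {0..1}"
    consider "t < 1/2" | "t = 1/2" | "t > 1/2" by linarith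
    then show "\<exists>c U F. t \<in> U \<and> local_rep c U F (\<gamma> +++ \<delta>)"
    proof cases
      case 1
      then show ?thesis using sr1(1) t by blast
    next
      case 3
      then show ?thesis using sr2(1) t by blast
    next
      case 2
      obtain c where c: "c \<in> A" "p \<in> fst c" by (rule ex_chart)
      \<comment> \<open>For \<open>s\<close> in this interval \<open>2 * s > 2/3\<close> and
        \<open>2 * s - 1 < 1/3\<close>, so the concatenation is constantly \<open>p\<close> on
        it.\<close>
      have "local_rep c {1/3<..<2/3} (\<lambda>s. snd c p) (\<gamma> +++ \<delta>)"
        using c flat by (auto simp: local_rep_def joinpaths_def Ck_on_const)
      moreover have "t \<in> {1/3<..<2/3}" using 2 by simp
      ultimately show ?thesis by blast
    qed
  qed
  obtain L where L: "continuous_on {0..1} L"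
    "\<And>t. t \<in> {0..1} \<Longrightarrow> (L has_vector_derivative speed A g \<gamma> t) (at t within {0..1})"
    "L 0 = 0" "L 1 = path_length A g \<gamma>"
    using arc_length_function[OF sp(1)] by metis
  obtain M where M: "continuous_on {0..1} M"
    "\<And>t. t \<in> {0..1} \<Longrightarrow> (M has_vector_derivative speed A g \<delta> t) (at t within {0..1})"
    "M 0 = 0" "M 1 = path_length A g \<delta>"
    using arc_length_function[OF sp(2)] by metis
  \<comment> \<open>\<open>N\<close> is the arc length function of the concatenation. At 1/2 only
    its continuity is checked; the strong form of the fundamental theorem admits this exceptional
    point.\<close>
  define N where "N t = (if t \<le> 1/2 then L (2 * t + 0) else L 1 + M (2 * t + (-1)))" for t
  have two: "((\<lambda>x::real. 2 * x + a) has_vector_derivative 2) (at t)" for a t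
    using DERIV_affine[of 2 a t] by (simp add: has_real_derivative_iff_has_vector_derivative)
  have "(N has_vector_derivative speed A g (\<gamma> +++ \<delta>) t) (at t)" if t: "t \<in> {0<..<1} - {1/2}" for t
  proof (cases "t < 1/2")
    case True
    then have t': "2 * t + 0 \<in> {0..1}" "2 * t + 0 \<in> {0<..<1}" using t by auto
    have "(L has_vector_derivative speed A g \<gamma> (2 * t + 0)) (at (2 * t + 0))"
      using L(2)[OF t'(1)] at_within_interior[of "2 * t + 0" "{0..1}"] t'(2) by simp
    from vector_diff_chain_at[OF two this]
    have "((\<lambda>t. L (2 * t + 0)) has_vector_derivative 2 * speed A g \<gamma> (2 * t + 0)) (at t)"
      by (simp add: o_def)
    moreover have "speed A g (\<gamma> +++ \<delta>) t = 2 * speed A g \<gamma> (2 * t + 0)"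
      using sr1(2)[of t] True t by simp
    ultimately have "((\<lambda>t. L (2 * t + 0)) has_vector_derivative speed A g (\<gamma> +++ \<delta>) t) (at t)"
      by (simp only:)
    then show ?thesis
      by (rule has_vector_derivative_transform_within_open[where S = "{..<1/2}"])
         (use True in \<open>auto simp: N_def\<close>)
  next
    case False
    then have t': "2 * t + (-1) \<in> {0..1}" "2 * t + (-1) \<in> {0<..<1}" using t by auto
    have "(M has_vector_derivative speed A g \<delta> (2 * t + (-1))) (at (2 * t + (-1)))"
      using M(2)[OF t'(1)] at_within_interior[of "2 * t + (-1)" "{0..1}"] t'(2) by simp
    from vector_diff_chain_at[OF two this]
    have "((\<lambda>t. M (2 * t + (-1))) has_vector_derivative 2 * speed A g \<delta> (2 * t + (-1))) (at t)"
      by (simp add: o_def)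
    from has_vector_derivative_add[OF has_vector_derivative_const this]
    have "((\<lambda>t. L 1 + M (2 * t + (-1))) has_vector_derivative 2 * speed A g \<delta> (2 * t + (-1))) (at t)"
      by simp
    moreover have "speed A g (\<gamma> +++ \<delta>) t = 2 * speed A g \<delta> (2 * t + (-1))"
      using sr2(2)[of t] False t by simp
    ultimately have "((\<lambda>t. L 1 + M (2 * t + (-1))) has_vector_derivative speed A g (\<gamma> +++ \<delta>) t) (at t)"
      by (simp only:)
    then show ?thesis
      by (rule has_vector_derivative_transform_within_open[where S = "{1/2<..}"])
         (use False t in \<open>auto simp: N_def\<close>)
  qed
  moreover have "continuous_on {0..1} N"
  proof -
    have "continuous_on ({0..1/2} \<union> {1/2..1}) N"
      unfolding N_def
    proof (rule continuous_on_cases)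
      show "continuous_on {0..1/2} (\<lambda>t. L (2 * t + 0))"
        by (rule continuous_on_compose2[OF L(1)]) (auto intro!: continuous_intros)
      show "continuous_on {1/2..1} (\<lambda>t. L 1 + M (2 * t + (-1)))"
        by (intro continuous_on_add continuous_on_const continuous_on_compose2[OF M(1)])
           (auto intro!: continuous_intros)
      have "L (2 * x + 0) = L 1 + M (2 * x + (-1))" if "x = 1/2" for x
      proof -
        have e: "2 * x + 0 = 1" "2 * x + (-1) = 0" using that by auto
        show ?thesis unfolding e M(3) by simp
      qed
      moreover have "x = 1/2" if "x \<in> {0..1/2} \<and> \<not> x \<le> 1/2 \<or> x \<in> {1/2..1} \<and> x \<le> 1/2" for x :: real
        using that by auto
      ultimately show "\<forall>x. x \<in> {0..1/2} \<and> \<not> x \<le> 1/2 \<or> x \<in> {1/2..1} \<and> x \<le> 1/2 \<longrightarrow>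
          L (2 * x + 0) = L 1 + M (2 * x + (-1))"
        by blast
    qed auto
    moreover have "{0..1/2} \<union> {1/2..1} = {0..1::real}" by auto
    ultimately show ?thesis by simp
  qed
  ultimately have "(speed A g (\<gamma> +++ \<delta>) has_integral N 1 - N 0) {0..1}"
    by (intro fundamental_theorem_of_calculus_interior_strong[of "{1/2}"]) auto
  then show "path_length A g (\<gamma> +++ \<delta>) = path_length A g \<gamma> + path_length A g \<delta>"
    using L(3,4) M(4) by (simp add: path_length_def integral_unique N_def)
qed

section \<open>The inner distance as a pseudometric\<close>

lemma inner_dist_nonneg: "0 \<le> inner_dist A g Y p q"
  unfolding inner_dist_def by (rule INF_greatest) (simp add: path_length_nonneg)

lemma inner_dist_le:
  assumes "smooth_path A \<gamma>" "path_image \<gamma> \<subseteq> manifold_interior Y"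
  shows "inner_dist A g Y (\<gamma> 0) (\<gamma> 1) \<le> ereal (path_length A g \<gamma>)"
  unfolding inner_dist_def
  by (rule INF_lower) (use assms in \<open>auto simp: pathstart_def pathfinish_def\<close>)

lemma inner_dist_lessE:
  assumes "inner_dist A g Y p q < C"
  obtains \<gamma> where "smooth_path A \<gamma>" "path_image \<gamma> \<subseteq> manifold_interior Y" "\<gamma> 0 = p" "\<gamma> 1 = q"
    "ereal (path_length A g \<gamma>) < C"
  using assms unfolding inner_dist_def INF_less_iff by (auto simp: pathstart_def pathfinish_def)

text \<open>The affine change of parameter may run backwards, so \<open>s > t\<close> is included;
  \<open>s = 1\<close> and \<open>t = 0\<close> give the reversed path, whence symmetry.\<close>

lemma inner_dist_subpath:
  assumes "smooth_path A \<gamma>" "path_image \<gamma> \<subseteq> manifold_interior Y" "s \<in> {0..1}" "t \<in> {0..1}"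
  shows "inner_dist A g Y (\<gamma> s) (\<gamma> t) \<le> ereal (path_length A g \<gamma>)"
proof -
  have rng: "(t - s) * x + s \<in> {0..1}" if "x \<in> {0..1}" for x
  proof -
    have "(1 - x) * s + x * t \<in> {0..1}"
      using convexD_alt[OF convex_real_interval(5)[of 0 1] assms(3,4), of x] that by simp
    then show ?thesis by (simp add: algebra_simps)
  qed
  have "(\<forall>x. 0 \<le> t - s) \<or> (\<forall>x. t - s \<le> 0)" by auto
  note r = reparam[OF assms(1) Ck_on_affine rng DERIV_affine this]
  have "path_image (\<gamma> \<circ> (\<lambda>x. (t - s) * x + s)) \<subseteq> manifold_interior Y"
    using assms(2) rng by (auto simp: path_image_def)
  from inner_dist_le[OF r(1) this] r(2) show ?thesis
    by (simp add: order_trans[where y = "ereal _"])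
qed

lemma inner_dist_sym_le: "inner_dist A g Y q p \<le> inner_dist A g Y p q"
proof (rule dense_ge)
  fix C assume "inner_dist A g Y p q < C"
  then obtain \<gamma> where \<gamma>: "smooth_path A \<gamma>" "path_image \<gamma> \<subseteq> manifold_interior Y" "\<gamma> 0 = p" "\<gamma> 1 = q"
    "ereal (path_length A g \<gamma>) < C"
    by (rule inner_dist_lessE)
  have "inner_dist A g Y q p \<le> ereal (path_length A g \<gamma>)"
    using inner_dist_subpath[OF \<gamma>(1,2), of 1 0] \<gamma>(3,4) by simp
  with \<gamma>(5) show "inner_dist A g Y q p \<le> C" by simp
qed

lemma inner_dist_sym: "inner_dist A g Y p q = inner_dist A g Y q p"
  using inner_dist_sym_le by (intro antisym)

text \<open>Paths within \<open>e / 2\<close> of the two infima are flattened at their ends before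
  being joined, since a plain concatenation could have a corner at \<open>q\<close>.\<close>

lemma inner_dist_triangle:
  "inner_dist A g Y p r \<le> inner_dist A g Y p q + inner_dist A g Y q r"
proof (cases "inner_dist A g Y p q = \<infinity> \<or> inner_dist A g Y q r = \<infinity>")
  case False
  obtain a where a: "inner_dist A g Y p q = ereal a"
    using False inner_dist_nonneg[of Y p q] by (cases "inner_dist A g Y p q") auto
  obtain b where b: "inner_dist A g Y q r = ereal b"
    using False inner_dist_nonneg[of Y q r] by (cases "inner_dist A g Y q r") auto
  show ?thesis
  proof (rule ereal_le_epsilon2)
    fix e :: real assume e: "0 < e"
    show "inner_dist A g Y p r \<le> inner_dist A g Y p q + inner_dist A g Y q r + ereal e"
    proof -
      have "inner_dist A g Y p q < ereal (a + e / 2)" using a e by simp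
      then obtain \<gamma> where \<gamma>: "smooth_path A \<gamma>" "path_image \<gamma> \<subseteq> manifold_interior Y" "\<gamma> 0 = p" "\<gamma> 1 = q"
        "ereal (path_length A g \<gamma>) < ereal (a + e / 2)"
        by (rule inner_dist_lessE)
      have "inner_dist A g Y q r < ereal (b + e / 2)" using b e by simp
      then obtain \<delta> where \<delta>: "smooth_path A \<delta>" "path_image \<delta> \<subseteq> manifold_interior Y" "\<delta> 0 = q" "\<delta> 1 = r"
        "ereal (path_length A g \<delta>) < ereal (b + e / 2)"
        by (rule inner_dist_lessE)
      obtain \<gamma>1 where \<gamma>1: "smooth_path A \<gamma>1" "path_length A g \<gamma>1 \<le> path_length A g \<gamma>"
        "path_image \<gamma>1 \<subseteq> path_image \<gamma>" "\<And>t. t \<le> 1/3 \<Longrightarrow> \<gamma>1 t = p" "\<And>t. t \<ge> 2/3 \<Longrightarrow> \<gamma>1 t = q"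
        using flatten[OF \<gamma>(1)] \<gamma>(3,4) by metis
      obtain \<delta>1 where \<delta>1: "smooth_path A \<delta>1" "path_length A g \<delta>1 \<le> path_length A g \<delta>"
        "path_image \<delta>1 \<subseteq> path_image \<delta>" "\<And>t. t \<le> 1/3 \<Longrightarrow> \<delta>1 t = q" "\<And>t. t \<ge> 2/3 \<Longrightarrow> \<delta>1 t = r"
        using flatten[OF \<delta>(1)] \<delta>(3,4) by metis
      note j = join_flat[OF \<gamma>1(1) \<delta>1(1) \<gamma>1(5) \<delta>1(4)]
      have "path_image (\<gamma>1 +++ \<delta>1) \<subseteq> manifold_interior Y"
        using path_image_join_subset[of \<gamma>1 \<delta>1] \<gamma>1(3) \<delta>1(3) \<gamma>(2) \<delta>(2) by blast
      from inner_dist_le[OF j(1) this]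
      have "inner_dist A g Y p r \<le> ereal (path_length A g \<gamma>1 + path_length A g \<delta>1)"
        using j(2) \<gamma>1(4)[of 0] \<delta>1(5)[of 1] by (simp add: joinpaths_def)
      also have "\<dots> \<le> ereal (a + b + e)"
        using \<gamma>1(2) \<delta>1(2) \<gamma>(5) \<delta>(5) by simp
      also have "\<dots> = inner_dist A g Y p q + inner_dist A g Y q r + ereal e"
        by (simp add: a b)
      finally show ?thesis .
    qed
  qed
qed (use inner_dist_nonneg in auto)

lemma inner_dist_refl:
  assumes "p \<in> manifold_interior Y"
  shows "inner_dist A g Y p p = 0"
proof -
  obtain c where c: "c \<in> A" "p \<in> fst c" by (rule ex_chart)
  have lr: "local_rep c UNIV (\<lambda>s. snd c p) (\<lambda>s. p)"
    using c by (simp add: local_rep_def Ck_on_const)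
  then have sp: "smooth_path A (\<lambda>s. p)" by (intro smooth_pathI) blast
  have "speed A g (\<lambda>s. p) t = 0" if "t \<in> {0..1}" for t
    using speed_local_rep[OF lr UNIV_I that, of 0] bilinear_lzero[OF metric_point(1)[OF c]] by simp
  then have "(speed A g (\<lambda>s. p) has_integral 0) {0..1}"
    by (intro has_integral_is_0)
  then have "path_length A g (\<lambda>s. p) = 0"
    unfolding path_length_def by (rule integral_unique)
  then have "inner_dist A g Y p p \<le> 0"
    using inner_dist_le[OF sp, of Y] assms by (simp add: path_image_def zero_ereal_def)
  then show ?thesis using inner_dist_nonneg[of Y p p] by simp
qed

end

section \<open>Chords and circular arcs\<close>

definition circ :: "real^2 \<Rightarrow> real \<Rightarrow> real \<Rightarrow> real^2" where
  "circ x r \<theta> = x + ((r * cos \<theta>) *\<^sub>R axis 1 1 + (r * sin \<theta>) *\<^sub>R axis 2 1)"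

lemma circ_component: "circ x r \<theta> $ 1 = x $ 1 + r * cos \<theta>" "circ x r \<theta> $ 2 = x $ 2 + r * sin \<theta>"
  by (simp_all add: circ_def axis_def)

lemma sphere_circ:
  assumes "u \<in> sphere x r" "0 < r"
  obtains \<theta> where "0 \<le> \<theta>" "\<theta> < 2 * pi" "u = circ x r \<theta>"
proof -
  let ?a = "(u $ 1 - x $ 1) / r" and ?b = "(u $ 2 - x $ 2) / r"
  have "dist x u ^ 2 = (x $ 1 - u $ 1)\<^sup>2 + (x $ 2 - u $ 2)\<^sup>2"
    by (simp add: dist_vec_def L2_set_def sum_2 dist_real_def)
  then have "r\<^sup>2 = (u $ 1 - x $ 1)\<^sup>2 + (u $ 2 - x $ 2)\<^sup>2"
    using assms(1) by (simp add: power2_commute)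
  then have "?a\<^sup>2 + ?b\<^sup>2 = r\<^sup>2 / r\<^sup>2"
    by (simp only: power_divide add_divide_distrib)
  then have "?a\<^sup>2 + ?b\<^sup>2 = 1" using assms(2) by simp
  then obtain t where "0 \<le> t" "t < 2 * pi" "?a = cos t" "?b = sin t"
    using sincos_total_2pi by metis
  moreover have "u = circ x r t"
    using calculation assms(2) by (simp add: vec_eq_iff forall_2 circ_component field_simps)
  ultimately show ?thesis using that by blast
qed

lemma circ_periodic: "circ x r (\<theta> + 2 * pi * of_int n) = circ x r \<theta>"
proof -
  have e: "\<theta> + 2 * pi * of_int n = \<theta> + of_int n * (2 * of_real pi)" by simp
  show ?thesis
    unfolding circ_def e sin.plus_of_int cos.plus_of_int by (rule refl)
qed

text \<open>If both arcs between \<open>u\<close> and \<open>v\<close> contained a point outside \<open>T\<close>, the line through these two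
  points would separate \<open>u\<close> from \<open>v\<close> without meeting \<open>T\<close>.\<close>

lemma connected_subset_circle:
  assumes T: "connected T" "T \<subseteq> sphere x r" "0 < r" and uv: "u \<in> T" "v \<in> T"
  obtains \<alpha> \<beta> where "\<bar>\<beta> - \<alpha>\<bar> \<le> 2 * pi" "u = circ x r \<alpha>" "v = circ x r \<beta>"
    "\<And>s. s \<in> {0..1} \<Longrightarrow> circ x r ((\<beta> - \<alpha>) * s + \<alpha>) \<in> T"
proof -
  \<comment> \<open>The case \<open>a \<le> b\<close>. The two candidate arcs run over the angles
    from \<open>a\<close> to \<open>b\<close> and from \<open>b\<close> to
    \<open>a + 2 * pi\<close>; exchanging \<open>u\<close> and \<open>v\<close> settles the other
    case.\<close>
  have main: "\<exists>\<alpha> \<beta>. \<bar>\<beta> - \<alpha>\<bar> \<le> 2 * pi \<and> u = circ x r \<alpha> \<and> v = circ x r \<beta> \<and>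
      (\<forall>\<theta>\<in>{min \<alpha> \<beta>..max \<alpha> \<beta>}. circ x r \<theta> \<in> T)"
    if a: "u \<in> T" "v \<in> T" "u = circ x r a" "v = circ x r b" "0 \<le> a" "a \<le> b" "b < 2 * pi" for a b u v
  proof (rule ccontr)
    assume neg: "\<not> ?thesis"
    have "\<exists>\<theta>\<in>{a..b}. circ x r \<theta> \<notin> T"
    proof (rule ccontr)
      assume "\<not> (\<exists>\<theta>\<in>{a..b}. circ x r \<theta> \<notin> T)"
      then have "\<forall>\<theta>\<in>{min a b..max a b}. circ x r \<theta> \<in> T" using a by auto
      moreover have "\<bar>b - a\<bar> \<le> 2 * pi" using a by auto
      ultimately show False using neg a(3,4) by blast
    qed
    then obtain \<mu> where \<mu>: "a \<le> \<mu>" "\<mu> \<le> b" "circ x r \<mu> \<notin> T" by auto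
    have per: "circ x r (a + 2 * pi) = u" using circ_periodic[of x r a 1] a by simp
    have "\<exists>\<theta>\<in>{b..a + 2 * pi}. circ x r \<theta> \<notin> T"
    proof (rule ccontr)
      assume "\<not> (\<exists>\<theta>\<in>{b..a + 2 * pi}. circ x r \<theta> \<notin> T)"
      then have "\<forall>\<theta>\<in>{min (a + 2 * pi) b..max (a + 2 * pi) b}. circ x r \<theta> \<in> T" using a by auto
      moreover have "\<bar>b - (a + 2 * pi)\<bar> \<le> 2 * pi" using a by auto
      ultimately show False using neg per[symmetric] a(4) by blast
    qed
    then obtain \<nu> where \<nu>: "b \<le> \<nu>" "\<nu> \<le> a + 2 * pi" "circ x r \<nu> \<notin> T" by auto
    have strict: "a < \<mu>" "\<mu> < b" "b < \<nu>" "\<nu> < a + 2 * pi"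
      using \<mu> \<nu> a per by (auto simp: less_le)
    \<comment> \<open>\<open>L\<close> is the affine function vanishing on the line through the
      omitted points at angles \<open>\<mu>\<close> and \<open>\<nu>\<close>; this line is
      perpendicular to the direction \<open>\<kappa>\<close>, at signed distance
      \<open>r * cos ((\<mu> - \<nu>) / 2)\<close> from the centre. On the circle \<open>L\<close>
      is a product of two sines, whose signs at \<open>u\<close> and \<open>v\<close> follow from
      \<open>a < \<mu> < b < \<nu> < a + 2 * pi\<close>.\<close>
    define \<kappa> where "\<kappa> = (\<mu> + \<nu>) / 2"
    define L where "L y = cos ((\<mu> - \<nu>) / 2) - (cos \<kappa> * (y $ 1 - x $ 1) + sin \<kappa> * (y $ 2 - x $ 2)) / r"
      for y :: "real^2"
    have L: "L (circ x r \<theta>) = 2 * sin ((\<theta> - \<nu>) / 2) * sin ((\<theta> - \<mu>) / 2)" for \<theta>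
    proof -
      have "L (circ x r \<theta>) = cos ((\<mu> - \<nu>) / 2) - cos (\<theta> - \<kappa>)"
        using T(3) by (simp add: L_def circ_component cos_diff field_simps)
      also have "\<dots> = 2 * sin (((\<mu> - \<nu>) / 2 + (\<theta> - \<kappa>)) / 2) * sin ((\<theta> - \<kappa> - (\<mu> - \<nu>) / 2) / 2)"
        by (rule cos_diff_cos)
      also have "((\<mu> - \<nu>) / 2 + (\<theta> - \<kappa>)) / 2 = (\<theta> - \<nu>) / 2"
        by (simp add: \<kappa>_def field_simps)
      also have "(\<theta> - \<kappa> - (\<mu> - \<nu>) / 2) / 2 = (\<theta> - \<mu>) / 2"
        by (simp add: \<kappa>_def field_simps)
      finally show ?thesis .
    qed
    have sin_neg: "sin t < 0" if "- pi < t" "t < 0" for t :: real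
      using sin_gt_zero[of "- t"] that by simp
    have "L u > 0"
    proof -
      have "sin ((a - \<nu>) / 2) < 0" "sin ((a - \<mu>) / 2) < 0"
        using strict a by (auto intro!: sin_neg simp: field_simps)
      then show ?thesis unfolding a(3) L by (simp add: mult_neg_neg)
    qed
    have "L v < 0"
    proof -
      have "sin ((b - \<nu>) / 2) < 0"
        using strict a by (auto intro!: sin_neg simp: field_simps)
      moreover have "sin ((b - \<mu>) / 2) > 0"
        using strict a by (auto intro!: sin_gt_zero simp: field_simps)
      ultimately show ?thesis unfolding a(4) L by (simp add: mult_neg_pos)
    qed
    have "continuous_on T L"
      unfolding L_def[abs_def] using T(3) by (intro continuous_intros) auto
    then have "connected (L ` T)" by (rule connected_continuous_image[OF _ T(1)])
    moreover have "L v \<in> L ` T" "L u \<in> L ` T" using a by auto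
    ultimately have "0 \<in> L ` T"
      using \<open>L u > 0\<close> \<open>L v < 0\<close> unfolding connected_iff_interval by (meson less_imp_le)
    then obtain y where y: "y \<in> T" "L y = 0" by force
    then obtain \<theta> where th: "y = circ x r \<theta>" using sphere_circ T(2,3) by blast
    \<comment> \<open>On the circle \<open>L\<close> vanishes only at the two omitted points, since
      a zero of either sine fixes the angle modulo \<open>2 * pi\<close>.\<close>
    have per2: "circ x r \<theta> = circ x r \<eta>" if s: "sin ((\<theta> - \<eta>) / 2) = 0" for \<eta>
    proof -
      obtain n :: int where "(\<theta> - \<eta>) / 2 = of_int n * pi"
        using s by (auto simp: sin_zero_iff_int2)
      then have "\<theta> = \<eta> + 2 * pi * of_int n" by (simp add: field_simps)
      then show ?thesis using circ_periodic by simp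
    qed
    have "sin ((\<theta> - \<nu>) / 2) = 0 \<or> sin ((\<theta> - \<mu>) / 2) = 0"
      using y(2) L[of \<theta>] th by simp
    then have "y = circ x r \<nu> \<or> y = circ x r \<mu>"
      using per2 th by blast
    then show False using y \<mu> \<nu> by auto
  qed
  obtain a where a: "0 \<le> a" "a < 2 * pi" "u = circ x r a"
    using sphere_circ T uv by blast
  obtain b where b: "0 \<le> b" "b < 2 * pi" "v = circ x r b"
    using sphere_circ T uv by blast
  have ex: "\<exists>\<alpha> \<beta>. \<bar>\<beta> - \<alpha>\<bar> \<le> 2 * pi \<and> u = circ x r \<alpha> \<and> v = circ x r \<beta> \<and>
      (\<forall>\<theta>\<in>{min \<alpha> \<beta>..max \<alpha> \<beta>}. circ x r \<theta> \<in> T)"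
  proof (cases "a \<le> b")
    case True
    then show ?thesis using main[OF uv a(3) b(3) a(1) _ b(2)] by blast
  next
    case False
    then obtain \<alpha> \<beta> where "\<bar>\<beta> - \<alpha>\<bar> \<le> 2 * pi" "v = circ x r \<alpha>" "u = circ x r \<beta>"
      "\<forall>\<theta>\<in>{min \<alpha> \<beta>..max \<alpha> \<beta>}. circ x r \<theta> \<in> T"
      using main[OF uv(2,1) b(3) a(3) b(1) _ a(2)] by force
    then show ?thesis
      by (intro exI[of _ \<beta>] exI[of _ \<alpha>]) (simp add: min.commute max.commute abs_minus_commute)
  qed
  then obtain \<alpha> \<beta> where ab: "\<bar>\<beta> - \<alpha>\<bar> \<le> 2 * pi" "u = circ x r \<alpha>" "v = circ x r \<beta>"
    "\<And>\<theta>. \<theta> \<in> {min \<alpha> \<beta>..max \<alpha> \<beta>} \<Longrightarrow> circ x r \<theta> \<in> T" by blast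
  show ?thesis
  proof (rule that[OF ab(1-3)])
    fix s :: real assume s: "s \<in> {0..1}"
    have "(1 - s) * \<alpha> + s * \<beta> \<in> {min \<alpha> \<beta>..max \<alpha> \<beta>}"
      using convexD_alt[OF convex_real_interval(5)[of "min \<alpha> \<beta>" "max \<alpha> \<beta>"], of \<alpha> \<beta> s] s by simp
    then have "(\<beta> - \<alpha>) * s + \<alpha> \<in> {min \<alpha> \<beta>..max \<alpha> \<beta>}" by (simp add: algebra_simps)
    then show "circ x r ((\<beta> - \<alpha>) * s + \<alpha>) \<in> T" by (rule ab(4))
  qed
qed

text \<open>One induction for both, each function being up to sign the derivative of the
  other.\<close>

lemma Ck_on_sin_cos: "Ck_on k UNIV (sin :: real \<Rightarrow> real)" "Ck_on k UNIV (cos :: real \<Rightarrow> real)"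
proof (induction k)
  case (Suc k)
  {
    case 1
    show ?case
    proof (rule Ck_on_SucI[where f' = "\<lambda>x v. cos x * v"])
      show "(sin has_derivative (\<lambda>v. cos x * v)) (at x)" for x :: real
        using DERIV_sin[of x] by (simp add: has_field_derivative_def)
      show "Ck_on k UNIV (\<lambda>x. cos x * v)" for v :: real
        by (intro Ck_on_mult Ck_on_const Suc.IH open_UNIV)
    qed simp
  next
    case 2
    show ?case
    proof (rule Ck_on_SucI[where f' = "\<lambda>x v. sin x * (- v)"])
      show "(cos has_derivative (\<lambda>v. sin x * (- v))) (at x)" for x :: real
      proof -
        have "(*) (- sin x) = (\<lambda>v. sin x * (- v))" by (simp add: fun_eq_iff)
        with DERIV_cos[of x] show ?thesis unfolding has_field_derivative_def by (simp only:)
      qed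
      show "Ck_on k UNIV (\<lambda>x. sin x * (- v))" for v :: real
        by (intro Ck_on_mult Ck_on_const Suc.IH open_UNIV)
    qed simp
  }
qed (simp_all add: continuous_on_sin continuous_on_cos)

lemma Ck_on_circ: "Ck_on k UNIV (\<lambda>s. circ x r (b * s + a))"
proof -
  have t: "Ck_on k UNIV (\<lambda>s. sin (b * s + a))" "Ck_on k UNIV (\<lambda>s. cos (b * s + a))"
    by (rule Ck_on_compose[OF open_UNIV open_UNIV subset_UNIV Ck_on_affine], rule Ck_on_sin_cos)+
  then show ?thesis
    unfolding circ_def
    by (intro Ck_on_add Ck_on_scaleR Ck_on_mult Ck_on_const open_UNIV)
qed

lemma circ_deriv:
  "((\<lambda>s. circ x r (b * s + a)) has_vector_derivative
     (b * r) *\<^sub>R ((- sin (b * s + a)) *\<^sub>R axis 1 1 + cos (b * s + a) *\<^sub>R axis 2 1)) (at s)"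
  unfolding circ_def has_vector_derivative_def
  by (auto intro!: derivative_eq_intros simp: algebra_simps)

context riemannian_surface
begin

text \<open>The speed is at least \<open>m\<close> times the coordinate speed up to time
  \<open>t\<close>, so the mean value inequality compares the displacement with the arc length
  function. After \<open>t\<close> the path may leave the chart.\<close>

lemma path_length_ge_chord:
  assumes sp: "smooth_path A \<gamma>" and c: "c \<in> A" and t: "t \<in> {0..1}" and m: "0 < m"
    and K: "\<And>s. s \<in> {0..t} \<Longrightarrow> \<gamma> s \<in> fst c \<and> snd c (\<gamma> s) \<in> K"
    and bound: "\<And>x v. x \<in> K \<Longrightarrow> m * norm v \<le> sqrt (g c (cinv c x) v v)"
  shows "m * norm (snd c (\<gamma> t) - snd c (\<gamma> 0)) \<le> path_length A g \<gamma>"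
proof (cases "t = 0")
  case True
  then show ?thesis using path_length_nonneg by simp
next
  case False
  then have t0: "0 < t" using t by simp
  obtain L where L: "continuous_on {0..1} L"
    "\<And>t. t \<in> {0..1} \<Longrightarrow> (L has_vector_derivative speed A g \<gamma> t) (at t within {0..1})"
    "L 0 = 0" "L 1 = path_length A g \<gamma>" "\<And>s t. 0 \<le> s \<Longrightarrow> s \<le> t \<Longrightarrow> t \<le> 1 \<Longrightarrow> L s \<le> L t"
    using arc_length_function[OF sp] by metis
  let ?f = "\<lambda>s. m *\<^sub>R snd c (\<gamma> s)"
  have cont: "continuous_on {0..1} \<gamma>" using sp by (simp add: smooth_path_def path_def)
  have "norm (?f t - ?f 0) \<le> L t - L 0"
  proof (rule differentiable_bound_general[OF t0])
    have "continuous_on {0..t} (\<lambda>s. snd c (\<gamma> s))"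
      by (rule continuous_on_compose2[OF chart_continuous(1)[OF c] continuous_on_subset[OF cont]])
         (use K t in auto)
    then show "continuous_on {0..t} ?f" by (intro continuous_intros)
    show "continuous_on {0..t} L" by (rule continuous_on_subset[OF L(1)]) (use t in auto)
    fix s assume s: "0 < s" "s < t"
    then have s1: "s \<in> {0..1}" "s \<in> {0<..<1}" "s \<in> {0..t}" using t by auto
    have Ks: "\<gamma> s \<in> fst c" "snd c (\<gamma> s) \<in> K" using K s1 by auto
    show "(L has_vector_derivative speed A g \<gamma> s) (at s)"
      using L(2)[OF s1(1)] at_within_interior[of s "{0..1}"] s1(2) by simp
    obtain U F where U: "s \<in> U" and lr: "local_rep c U F \<gamma>"
      using smooth_path_local_rep[OF sp s1(1) c Ks(1)] by blast
    note r = local_repD[OF lr]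
    let ?v = "vector_derivative F (at s)"
    have F: "(F has_vector_derivative ?v) (at s)"
      by (rule Ck_on_has_vector_derivative[OF r(3) U])
    have "((\<lambda>s. snd c (\<gamma> s)) has_vector_derivative ?v) (at s)"
      by (rule has_vector_derivative_transform_within_open[OF F, of "U \<inter> {0<..<1}"])
         (use r(2) r(5) U s1 in \<open>auto intro!: open_Int\<close>)
    then have df: "(?f has_vector_derivative m *\<^sub>R ?v) (at s)"
      by (rule bounded_linear.has_vector_derivative[OF bounded_linear_scaleR_right])
    then show "(?f has_vector_derivative vector_derivative ?f (at s)) (at s)"
      by (simp add: vector_derivative_at)
    have "m * norm ?v \<le> sqrt (g c (cinv c (snd c (\<gamma> s))) ?v ?v)"
      by (rule bound[OF Ks(2)])
    also have "\<dots> = speed A g \<gamma> s"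
      using speed_local_rep'[OF lr U s1(1)] c Ks(1) by simp
    finally show "norm (vector_derivative ?f (at s)) \<le> speed A g \<gamma> s"
      using vector_derivative_at[OF df] m by simp
  qed
  also have "\<dots> \<le> path_length A g \<gamma>" using L(3,4) L(5)[of t 1] t by auto
  also have "?f t - ?f 0 = m *\<^sub>R (snd c (\<gamma> t) - snd c (\<gamma> 0))" by (simp add: algebra_simps)
  finally show ?thesis using m by simp
qed

text \<open>Connectedness of \<open>T\<close> provides an arc of the circle from \<open>u\<close> to
  \<open>v\<close> inside \<open>T\<close>. The factor \<open>4 * pi\<close> is a full turn of
  \<open>2 * pi\<close> times the crude bound 2 for the norm of a unit tangent vector.\<close>

lemma inner_dist_arc:
  assumes c: "c \<in> A" and T: "connected T" "T \<subseteq> sphere x r" "0 < r" "T \<subseteq> snd c ` fst c"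
    and int: "cinv c ` T \<subseteq> manifold_interior Y" and uv: "u \<in> T" "v \<in> T"
    and M: "0 < M" "\<And>y w. y \<in> T \<Longrightarrow> sqrt (g c (cinv c y) w w) \<le> M * norm w"
  shows "inner_dist A g Y (cinv c u) (cinv c v) \<le> ereal (4 * pi * M * r)"
proof -
  obtain \<alpha> \<beta> where ab: "\<bar>\<beta> - \<alpha>\<bar> \<le> 2 * pi" "u = circ x r \<alpha>" "v = circ x r \<beta>"
    "\<And>s. s \<in> {0..1} \<Longrightarrow> circ x r ((\<beta> - \<alpha>) * s + \<alpha>) \<in> T"
    using connected_subset_circle[OF T(1-3) uv] by metis
  let ?F = "\<lambda>s. circ x r ((\<beta> - \<alpha>) * s + \<alpha>)"
  let ?\<gamma> = "\<lambda>s. cinv c (?F s)"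
  have lr: "local_rep c UNIV ?F ?\<gamma>"
    unfolding local_rep_def
  proof (intro conjI ballI allI)
    fix s :: real assume "s \<in> UNIV \<inter> {0..1}"
    then have "?F s \<in> snd c ` fst c" using ab(4)[of s] T(4) by blast
    then show "?\<gamma> s \<in> fst c" "snd c (?\<gamma> s) = ?F s"
      by (rule cinv_in, rule cinv_right)
  qed (use c Ck_on_circ in auto)
  have sp: "smooth_path A ?\<gamma>" by (rule smooth_pathI) (use lr in blast)
  have sb: "speed A g ?\<gamma> s \<le> 4 * pi * M * r" if s: "s \<in> {0..1}" for s
  proof -
    let ?\<theta> = "(\<beta> - \<alpha>) * s + \<alpha>"
    let ?w = "((\<beta> - \<alpha>) * r) *\<^sub>R ((- sin ?\<theta>) *\<^sub>R axis 1 1 + cos ?\<theta> *\<^sub>R axis 2 1) :: real^2"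
    have "speed A g ?\<gamma> s = sqrt (g c (?\<gamma> s) ?w ?w)"
      by (rule speed_local_rep[OF lr UNIV_I s circ_deriv])
    also have "\<dots> \<le> M * norm ?w" by (rule M(2)[OF ab(4)[OF s]])
    also have "\<dots> \<le> M * (2 * pi * r * 2)"
    proof (rule mult_left_mono)
      have "norm ((- sin ?\<theta>) *\<^sub>R axis 1 1 + cos ?\<theta> *\<^sub>R axis 2 1 :: real^2) \<le> \<bar>sin ?\<theta>\<bar> + \<bar>cos ?\<theta>\<bar>"
        by (rule order_trans[OF norm_triangle_ineq]) simp
      also have "\<dots> \<le> 2" using abs_sin_le_one[of ?\<theta>] abs_cos_le_one[of ?\<theta>] by linarith
      finally have "norm ((- sin ?\<theta>) *\<^sub>R axis 1 1 + cos ?\<theta> *\<^sub>R axis 2 1 :: real^2) \<le> 2" .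
      moreover have "\<bar>(\<beta> - \<alpha>) * r\<bar> \<le> 2 * pi * r"
        using ab(1) T(3) by (simp add: abs_mult)
      ultimately show "norm ?w \<le> 2 * pi * r * 2"
        unfolding norm_scaleR using T(3) by (intro mult_mono) auto
    qed (use M(1) in simp)
    finally show ?thesis by (simp add: algebra_simps)
  qed
  have "path_length A g ?\<gamma> \<le> integral {0..1::real} (\<lambda>s. 4 * pi * M * r)"
    unfolding path_length_def
    by (rule integral_le[OF integrable_continuous_real[OF speed_continuous[OF sp]]]) (use sb in auto)
  also have "\<dots> = 4 * pi * M * r" by simp
  finally have len: "path_length A g ?\<gamma> \<le> 4 * pi * M * r" .
  have "path_image ?\<gamma> \<subseteq> manifold_interior Y"
    using ab(4) int by (auto simp: path_image_def)
  from inner_dist_le[OF sp this]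
  have "inner_dist A g Y (cinv c u) (cinv c v) \<le> ereal (path_length A g ?\<gamma>)"
    using ab(2,3) by simp
  also have "\<dots> \<le> ereal (4 * pi * M * r)" using len by simp
  finally show ?thesis .
qed

end

section \<open>The interior of a surface with boundary\<close>

text \<open>\<open>t\<close> is the least time outside \<open>B\<close>. It exists because these
  times form a compact set, \<open>B\<close> being relatively open in \<open>Y\<close>, and
  \<open>\<gamma> t\<close> is a limit of points of \<open>B\<close>, hence in
  \<open>B'\<close>.\<close>

lemma first_exit:
  fixes \<gamma> :: "real \<Rightarrow> 'a::t2_space"
  assumes cont: "continuous_on {0..1} \<gamma>" and Y: "\<gamma> ` {0..1} \<subseteq> Y"
    and B: "openin (top_of_set Y) B" "closed B'" "B \<subseteq> B'" and ends: "\<gamma> 0 \<in> B" "\<gamma> 1 \<notin> B"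
  obtains t where "t \<in> {0..1}" "\<gamma> ` {0..<t} \<subseteq> B" "\<gamma> t \<in> B' - B"
proof -
  obtain G where G: "open G" "B = Y \<inter> G" using B(1) by (auto simp: openin_open)
  let ?Z = "{t \<in> {0..1}. \<gamma> t \<notin> B}"
  have "\<gamma> t \<in> Y" if "t \<in> {0..1}" for t using Y that by blast
  then have Z: "?Z = {0..1} \<inter> \<gamma> -` (- G)" using G(2) by auto
  have "closed ?Z"
    unfolding Z using G(1) by (intro continuous_closed_preimage cont) auto
  moreover have "bounded ?Z" by (rule bounded_subset[of "{0..1}"]) auto
  ultimately have comp: "compact ?Z" by (simp only: compact_eq_bounded_closed)
  have ne: "?Z \<noteq> {}" using ends by auto
  obtain t where t: "t \<in> ?Z" "\<And>s. s \<in> ?Z \<Longrightarrow> t \<le> s"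
    using compact_attains_inf[OF comp ne] by blast
  have before: "\<gamma> ` {0..<t} \<subseteq> B" using t by force
  have "t \<noteq> 0" using t ends by auto
  then have t0: "0 < t" using t by auto
  have "closed ({0..1} \<inter> \<gamma> -` B')"
    using B(2) by (intro continuous_closed_preimage cont) auto
  moreover have "{0..<t} \<subseteq> {0..1} \<inter> \<gamma> -` B'" using before B(3) t by auto
  ultimately have "closure {0..<t} \<subseteq> {0..1} \<inter> \<gamma> -` B'" by (rule closure_minimal[rotated])
  moreover have "t \<in> closure {0..<t}" using t0 by simp
  ultimately have "\<gamma> t \<in> B'" by blast
  with t before show ?thesis using that by auto
qed

section \<open>Discs and circles in the half plane, and invariance of the boundary\<close>

lemma upper_half_plane: "convex {x::real^2. 0 < x $ 2}" "open {x::real^2. 0 < x $ 2}"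
proof -
  show "convex {x::real^2. 0 < x $ 2}"
    using convex_halfspace_gt[of 0 "axis 2 (1::real) :: real^2"] by (simp add: inner_axis')
  show "open {x::real^2. 0 < x $ 2}" by (intro open_Collect_less continuous_intros)
qed

lemma closed_half_plane: "closed half_plane"
  unfolding half_plane_def by (intro closed_Collect_le continuous_intros)

lemma half_plane_not_neighbourhood:
  assumes "open N" "N \<subseteq> half_plane" "x \<in> N"
  shows "0 < x $ 2"
proof (rule ccontr)
  assume "\<not> 0 < x $ 2"
  then have x: "x $ 2 = 0" using assms by (auto simp: half_plane_def)
  obtain e where e: "e > 0" "ball x e \<subseteq> N" using assms openE by blast
  have "x - (e / 2) *\<^sub>R axis 2 1 \<in> ball x e" using e(1) by (simp add: dist_norm)
  then have "x - (e / 2) *\<^sub>R axis 2 1 \<in> half_plane" using e assms by blast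
  then show False using x e(1) by (simp add: half_plane_def)
qed

text \<open>Two cases only: either the circle lies wholly above the boundary line, or its centre is
  on that line and the half circle is the radial projection of the open upper half plane. The third
  hypothesis excludes a circle about a higher centre that reaches the line.\<close>

lemma connected_half_sphere:
  assumes "0 < s" "w \<in> half_plane" "0 < w $ 2 \<Longrightarrow> s < w $ 2"
  shows "connected (sphere w s \<inter> {x::real^2. 0 < x $ 2})"
proof (cases "0 < w $ 2")
  case True
  have "x $ 2 > 0" if "x \<in> sphere w s" for x
    using component_le_norm_cart[of "w - x" 2] that assms(3)[OF True] by (auto simp: dist_norm)
  then have "sphere w s \<inter> {x::real^2. 0 < x $ 2} = sphere w s" by auto
  then show ?thesis using connected_sphere[of w s] by simp
next
  case False
  then have w: "w $ 2 = 0" using assms(2) by (simp add: half_plane_def)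
  let ?P = "{x::real^2. 0 < x $ 2}"
  let ?k = "\<lambda>x. w + (s / norm (x - w)) *\<^sub>R (x - w)"
  have ne: "x - w \<noteq> 0" if "x \<in> ?P" for x using that w by auto
  have "sphere w s \<inter> ?P = ?k ` ?P"
  proof (intro equalityI subsetI)
    fix x assume x: "x \<in> sphere w s \<inter> ?P"
    then have "norm (x - w) = s" by (simp add: dist_norm norm_minus_commute)
    then have "?k x = x" using assms(1) by simp
    moreover have "?k x \<in> ?k ` ?P" using x by blast
    ultimately show "x \<in> ?k ` ?P" by (simp only:)
  next
    fix u assume "u \<in> ?k ` ?P"
    then obtain x where x: "x \<in> ?P" "u = ?k x" by blast
    have "0 < s / norm (x - w)" using ne[OF x(1)] assms(1) by simp
    moreover have "u $ 2 = (s / norm (x - w)) * x $ 2" using x(2) w by simp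
    ultimately have "u \<in> ?P" using x(1) by (simp only: mem_Collect_eq mult_pos_pos)
    moreover have "norm (u - w) = s" using x(2) ne[OF x(1)] assms(1) by simp
    then have "u \<in> sphere w s" by (simp add: dist_norm norm_minus_commute)
    ultimately show "u \<in> sphere w s \<inter> ?P" by blast
  qed
  moreover have "connected (?k ` ?P)"
  proof (rule connected_continuous_image)
    show "continuous_on ?P ?k" using ne by (intro continuous_intros) auto
    show "connected ?P" using upper_half_plane(1) convex_connected by blast
  qed
  ultimately show ?thesis by simp
qed

text \<open>An open box clipped at the boundary line is homeomorphic to the plane. Coordinates
  differ from those of \<open>w\<close> by less than \<open>2 * s\<close>, which gives
  \<open>4 * s\<close> through the sum norm.\<close>

lemma half_box:
  fixes w :: "real^2"
  assumes s: "0 < s" and w: "w \<in> half_plane"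
  obtains D where "D homeomorphic (UNIV :: (real^2) set)" "D \<subseteq> {x. 0 < x $ 2}" "D \<subseteq> cball w (4 * s)"
    "cball w s \<inter> {x. 0 < x $ 2} \<subseteq> D"
proof
  let ?a = "(\<chi> i. if i = 1 then w $ 1 - 2 * s else max 0 (w $ 2 - 2 * s)) :: real^2"
  let ?b = "(\<chi> i. w $ i + 2 * s) :: real^2"
  have w2: "0 \<le> w $ 2" using w by (simp add: half_plane_def)
  have mem: "x \<in> box ?a ?b \<longleftrightarrow> w $ 1 - 2 * s < x $ 1 \<and> x $ 1 < w $ 1 + 2 * s \<and>
      0 < x $ 2 \<and> w $ 2 - 2 * s < x $ 2 \<and> x $ 2 < w $ 2 + 2 * s" for x
    by (auto simp: mem_box_cart forall_2)
  show sub: "cball w s \<inter> {x. 0 < x $ 2} \<subseteq> box ?a ?b"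
  proof
    fix x assume "x \<in> cball w s \<inter> {x. 0 < x $ 2}"
    then show "x \<in> box ?a ?b"
      unfolding mem using s component_le_norm_cart[of "w - x" 1] component_le_norm_cart[of "w - x" 2]
      by (auto simp: dist_norm)
  qed
  have "w + (s / 2) *\<^sub>R axis 2 1 \<in> cball w s \<inter> {x. 0 < x $ 2}"
    using s w2 by (simp add: dist_norm)
  then have "box ?a ?b \<noteq> {}" using sub by blast
  then show "box ?a ?b homeomorphic (UNIV :: (real^2) set)"
    by (rule homeomorphic_box_UNIV)
  show "box ?a ?b \<subseteq> {x. 0 < x $ 2}" using mem by blast
  show "box ?a ?b \<subseteq> cball w (4 * s)"
  proof
    fix x assume "x \<in> box ?a ?b"
    then have "\<bar>(w - x) $ 1\<bar> + \<bar>(w - x) $ 2\<bar> \<le> 4 * s" unfolding mem by auto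
    then show "x \<in> cball w (4 * s)"
      using norm_le_l1_cart[of "w - x"] by (simp add: dist_norm sum_2)
  qed
qed

text \<open>If the second coordinate is positive, the chart can be cut down to the open upper half
  plane. Conversely, a plane chart at \<open>q\<close> makes the change of charts an injective
  continuous map on an open plane set; by invariance of domain its image is open in the plane, and
  an open subset of the half plane misses the boundary line.\<close>

lemma manifold_interior_half_plane:
  fixes Y :: "'a::t2_space set"
  assumes V: "openin (top_of_set Y) V" and W: "openin (top_of_set half_plane) W"
    and hom: "homeomorphism V W \<psi> \<phi>" and q: "q \<in> V"
  shows "q \<in> manifold_interior Y \<longleftrightarrow> 0 < \<psi> q $ 2"
proof
  assume "0 < \<psi> q $ 2"
  let ?P = "{x::real^2. 0 < x $ 2}"
  obtain G where G: "open G" "W = half_plane \<inter> G" using W by (auto simp: openin_open)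
  have WP: "W \<inter> ?P = G \<inter> ?P" using G(2) by (auto simp: half_plane_def)
  have "openin (top_of_set V) (\<phi> ` (W \<inter> ?P))"
    by (rule homeomorphism_imp_open_map[OF homeomorphism_symD[OF hom]])
       (use upper_half_plane(2) in auto)
  from openin_trans[OF this V] have "openin (top_of_set Y) (\<phi> ` (W \<inter> ?P))" .
  moreover have "homeomorphism (W \<inter> ?P) (\<phi> ` (W \<inter> ?P)) \<phi> \<psi>"
    by (rule homeomorphism_of_subsets[OF homeomorphism_symD[OF hom]]) auto
  from homeomorphism_symD[OF this] have "\<phi> ` (W \<inter> ?P) homeomorphic (W \<inter> ?P)"
    unfolding homeomorphic_def by blast
  moreover have "open (W \<inter> ?P)" unfolding WP using G(1) upper_half_plane(2) by (rule open_Int)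
  moreover have "\<psi> q \<in> W" "\<phi> (\<psi> q) = q" using hom q unfolding homeomorphism_def by auto
  then have "q \<in> \<phi> ` (W \<inter> ?P)" using \<open>0 < \<psi> q $ 2\<close> by (intro image_eqI[of _ _ "\<psi> q"]) auto
  moreover have "q \<in> Y" using q openin_imp_subset[OF V] by blast
  ultimately show "q \<in> manifold_interior Y" unfolding manifold_interior_def by blast
next
  assume "q \<in> manifold_interior Y"
  then obtain V2 and W2 :: "(real^2) set" where V2: "openin (top_of_set Y) V2" "q \<in> V2" "open W2" "V2 homeomorphic W2"
    by (auto simp: manifold_interior_def)
  then obtain f h where fh: "homeomorphism V2 W2 f h" by (auto simp: homeomorphic_def)
  let ?N = "V \<inter> V2"
  have hf: "h (f u) = u" if "u \<in> ?N" for u using fh that by (auto simp: homeomorphism_def)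
  have "openin (top_of_set V2) ?N"
    by (rule openin_subset_trans[OF openin_Int[OF V V2(1)]]) (use openin_imp_subset[OF V2(1)] in auto)
  then have "openin (top_of_set W2) (f ` ?N)"
    by (rule homeomorphism_imp_open_map[OF fh])
  then have o: "open (f ` ?N)" using V2(3) openin_open_trans by blast
  have fW: "f ` ?N \<subseteq> W2" using fh by (auto simp: homeomorphism_def)
  have "continuous_on (f ` ?N) (\<lambda>u. \<psi> (h u))"
    by (rule continuous_on_compose2[OF homeomorphism_cont1[OF hom] continuous_on_subset[OF homeomorphism_cont2[OF fh] fW]])
       (use hf in auto)
  moreover have "inj_on (\<lambda>u. \<psi> (h u)) (f ` ?N)"
  proof (rule inj_onI)
    fix a b assume "a \<in> f ` ?N" "b \<in> f ` ?N" and eq: "\<psi> (h a) = \<psi> (h b)"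
    then obtain u v where uv: "u \<in> ?N" "v \<in> ?N" "a = f u" "b = f v" by blast
    then have "\<psi> u = \<psi> v" using eq hf by simp
    then have "u = v" using hom uv(1,2) unfolding homeomorphism_def by (metis IntE)
    then show "a = b" using uv by simp
  qed
  ultimately have o2: "open ((\<lambda>u. \<psi> (h u)) ` f ` ?N)"
    using o by (intro invariance_of_domain)
  have im: "(\<lambda>u. \<psi> (h u)) ` f ` ?N = \<psi> ` ?N"
    unfolding image_image by (rule image_cong) (use hf in auto)
  have "\<psi> ` ?N \<subseteq> half_plane"
    using hom openin_imp_subset[OF W] by (auto simp: homeomorphism_def)
  then show "0 < \<psi> q $ 2"
    by (rule half_plane_not_neighbourhood[OF o2[unfolded im]]) (use q V2 in auto)
qed

section \<open>Crossing a small circle\<close>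

text \<open>The corresponding statement for closed subsets of the plane, carried over to
  \<open>D\<close>. Separation is phrased by connected sets containing \<open>p\<close>, because
  these are what the homeomorphism transports in both directions.\<close>

lemma separating_component:
  fixes D S :: "'a::topological_space set"
  assumes D: "D homeomorphic (UNIV :: (real^2) set)" and S: "closed S"
    and pq: "p \<in> D" "q \<in> D" and sep: "\<And>E. connected E \<Longrightarrow> E \<subseteq> D - S \<Longrightarrow> p \<in> E \<Longrightarrow> q \<notin> E"
  obtains \<sigma> where "connected \<sigma>" "\<sigma> \<subseteq> D \<inter> S"
    "\<forall>E. connected E \<and> E \<subseteq> D - \<sigma> \<and> p \<in> E \<longrightarrow> q \<notin> E"
proof -
  obtain \<theta> \<eta> where hom: "homeomorphism D (UNIV :: (real^2) set) \<theta> \<eta>"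
    using D by (auto simp: homeomorphic_def)
  have te: "\<theta> (\<eta> u) = u" "\<eta> u \<in> D" for u using hom by (auto simp: homeomorphism_def)
  have et: "\<eta> (\<theta> d) = d" if "d \<in> D" for d using hom that by (auto simp: homeomorphism_def)
  have cont: "continuous_on D \<theta>" "continuous_on UNIV \<eta>" using hom by (auto simp: homeomorphism_def)
  let ?K = "\<theta> ` (D \<inter> S)"
  have "closedin (top_of_set UNIV) ?K"
    by (rule homeomorphism_imp_closed_map[OF hom closedin_closed_Int[OF S]])
  then have K: "closed ?K" by simp
  have "\<not> connected_component (- ?K) (\<theta> p) (\<theta> q)"
  proof
    assume "connected_component (- ?K) (\<theta> p) (\<theta> q)"
    then obtain T where T: "connected T" "T \<subseteq> - ?K" "\<theta> p \<in> T" "\<theta> q \<in> T"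
      by (auto simp: connected_component_def)
    have "connected (\<eta> ` T)"
      by (rule connected_continuous_image[OF continuous_on_subset[OF cont(2)] T(1)]) auto
    moreover have "\<eta> ` T \<subseteq> D - S"
    proof (rule image_subsetI)
      fix u assume "u \<in> T"
      moreover have "u \<in> ?K" if "\<eta> u \<in> S" by (rule image_eqI[of _ _ "\<eta> u"]) (use te that in auto)
      ultimately show "\<eta> u \<in> D - S" using T(2) te(2) by blast
    qed
    moreover have "p \<in> \<eta> ` T" "q \<in> \<eta> ` T"
      using imageI[OF T(3), of \<eta>] imageI[OF T(4), of \<eta>] et pq by simp_all
    ultimately show False using sep by blast
  qed
  then obtain C where C: "C \<in> components ?K" "\<not> connected_component (- C) (\<theta> p) (\<theta> q)"
    using separation_by_component_closed_pointwise[OF K] by blast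
  show ?thesis
  proof (rule that[of "\<eta> ` C"])
    show "connected (\<eta> ` C)"
      using connected_continuous_image[OF continuous_on_subset[OF cont(2)] in_components_connected[OF C(1)]]
      by auto
    show "\<eta> ` C \<subseteq> D \<inter> S"
    proof
      fix d assume "d \<in> \<eta> ` C"
      then obtain u where u: "u \<in> C" "d = \<eta> u" by blast
      then have "u \<in> ?K" using in_components_subset[OF C(1)] by blast
      then show "d \<in> D \<inter> S" using u(2) et by auto
    qed
    have "q \<notin> E" if E: "connected E" "E \<subseteq> D - \<eta> ` C" "p \<in> E" for E
    proof -
    have "connected (\<theta> ` E)"
      by (rule connected_continuous_image[OF continuous_on_subset[OF cont(1)] E(1)]) (use E(2) in blast)
    moreover have "\<theta> ` E \<subseteq> - C"
    proof
      fix u assume "u \<in> \<theta> ` E"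
      then obtain d where d: "d \<in> E" "u = \<theta> d" by blast
      then have "\<eta> u = d" "d \<notin> \<eta> ` C" using E(2) et by auto
      then show "u \<in> - C" by blast
    qed
    ultimately have "connected_component (- C) (\<theta> p) (\<theta> q)" if "q \<in> E"
      unfolding connected_component_def using E(3) that by blast
    then show "q \<notin> E" using C(2) by blast
    qed
    then show "\<forall>E. connected E \<and> E \<subseteq> D - \<eta> ` C \<and> p \<in> E \<longrightarrow> q \<notin> E" by blast
  qed
qed

context riemannian_surface
begin

lemma cinv_image_iff:
  assumes "c \<in> A" "K \<subseteq> snd c ` fst c"
  shows "p \<in> cinv c ` K \<longleftrightarrow> p \<in> fst c \<and> snd c p \<in> K"
proof
  assume "p \<in> cinv c ` K"
  then obtain u where u: "u \<in> K" "p = cinv c u" by blast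
  then have "u \<in> snd c ` fst c" using assms(2) by blast
  from cinv_in[OF this] cinv_right[OF this] show "p \<in> fst c \<and> snd c p \<in> K" using u by simp
next
  assume "p \<in> fst c \<and> snd c p \<in> K"
  then show "p \<in> cinv c ` K" using assms(1) by (intro image_eqI[of _ _ "snd c p"]) auto
qed

lemma cinv_open:
  assumes "c \<in> A" "open W" "W \<subseteq> snd c ` fst c"
  shows "open (cinv c ` W)"
proof -
  have "cinv c ` W = {p \<in> fst c. snd c p \<in> W}"
    using cinv_image_iff[OF assms(1,3)] by blast
  then show ?thesis using open_chart_preimage[OF assms(1,2)] by simp
qed

lemma cinv_compact:
  assumes "c \<in> A" "compact K" "K \<subseteq> snd c ` fst c"
  shows "closed (cinv c ` K)"
  by (intro compact_imp_closed compact_continuous_image assms(2)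
      continuous_on_subset[OF chart_continuous(2)[OF assms(1)] assms(3)])

text \<open>Near \<open>y\<close> there is a half disc of \<open>Y\<close>.  Inside it, a component of a small circle about \<open>y\<close>
  separates the points near \<open>y\<close> from the half circle bounding it, and hence is crossed by every
  path in the interior of \<open>Y\<close> coming from afar.\<close>

lemma crossing:
  fixes Y :: "'a set"
  assumes Y: "C0_submanifold_with_boundary Y" and y: "y \<in> Y" "x \<noteq> y" "z \<noteq> y"
    and c: "c \<in> A" "y \<in> fst c"
  obtains R G where "0 < R" "open G" "x \<in> G" "z \<in> G"
    "cball (snd c y) R \<subseteq> snd c ` fst c"
    "\<forall>r. 0 < r \<and> r \<le> R \<longrightarrow> (\<exists>N. open N \<and> y \<in> N \<and> (\<exists>T. connected T \<and> T \<subseteq> sphere (snd c y) r \<and>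
       cinv c ` T \<subseteq> manifold_interior Y \<and>
       (\<forall>\<gamma>. path \<gamma> \<and> path_image \<gamma> \<subseteq> manifold_interior Y \<and> \<gamma> 0 \<in> N \<and> \<gamma> 1 \<in> G \<longrightarrow>
         (\<exists>t\<in>{0..1}. \<gamma> t \<in> cinv c ` T))))"
proof -
  let ?I = "manifold_interior Y" and ?H = "half_plane" and ?P = "{u::real^2. 0 < u $ 2}"
  have IY: "?I \<subseteq> Y" by (auto simp: manifold_interior_def)
  have PH: "?P \<subseteq> ?H" by (auto simp: half_plane_def)
  obtain V and W :: "(real^2) set" where V: "openin (top_of_set Y) V" "y \<in> V" "openin (top_of_set ?H) W" "V homeomorphic W"
    using Y y(1) unfolding C0_submanifold_with_boundary_def by blast
  then obtain \<psi> \<phi> where hom: "homeomorphism V W \<psi> \<phi>" by (auto simp: homeomorphic_def)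
  note bdry = manifold_interior_half_plane[OF V(1,3) hom]
  have fp: "\<phi> (\<psi> q) = q" "\<psi> q \<in> W" if "q \<in> V" for q using hom that by (auto simp: homeomorphism_def)
  have pf: "\<psi> (\<phi> u) = u" "\<phi> u \<in> V" if "u \<in> W" for u using hom that by (auto simp: homeomorphism_def)
  have cont\<phi>: "continuous_on W \<phi>" using hom by (simp add: homeomorphism_def)
  have WH: "W \<subseteq> ?H" using openin_imp_subset[OF V(3)] .
  have VY: "V \<subseteq> Y" using openin_imp_subset[OF V(1)] .
  let ?w = "\<psi> y"
  have wW: "?w \<in> W" using fp V(2) by blast
  then have wH: "?w \<in> ?H" using WH by blast
  have intW: "\<phi> u \<in> ?I \<longleftrightarrow> 0 < u $ 2" if "u \<in> W" for u
    using bdry[OF pf(2)[OF that]] pf(1)[OF that] by simp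
  obtain O' where O': "open O'" "W = ?H \<inter> O'" using V(3) by (auto simp: openin_open)
  then obtain e where e: "0 < e" "cball ?w e \<subseteq> O'" using wW open_contains_cball by blast
  \<comment> \<open>Points other than \<open>y\<close> lie outside all sufficiently small half
    discs, so the complement of one such half disc can serve as \<open>G\<close>.\<close>
  have far: "\<exists>d>0. \<forall>s<d. q \<notin> \<phi> ` (cball ?w s \<inter> W)" if "q \<noteq> y" for q
  proof (cases "q \<in> V")
    case True
    then have "\<psi> q \<noteq> ?w" using that fp V(2) by metis
    then have "dist ?w (\<psi> q) > 0" by simp
    moreover have "q \<notin> \<phi> ` (cball ?w s \<inter> W)" if "s < dist ?w (\<psi> q)" for s
      using that pf by auto
    ultimately show ?thesis by blast
  next
    case False
    then show ?thesis using pf by (intro exI[of _ 1]) auto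
  qed
  obtain dx where dx: "dx > 0" "\<And>s. s < dx \<Longrightarrow> x \<notin> \<phi> ` (cball ?w s \<inter> W)" using far y by blast
  obtain dz where dz: "dz > 0" "\<And>s. s < dz \<Longrightarrow> z \<notin> \<phi> ` (cball ?w s \<inter> W)" using far y by blast
  \<comment> \<open>\<open>e / 4\<close> keeps the box around the half disc inside \<open>W\<close>;
    \<open>dx / 2\<close> and \<open>dz / 2\<close> leave \<open>x\<close> and \<open>z\<close>
    outside; the last term makes the half disc a whole disc when \<open>y\<close> is an interior
    point, as \<open>connected_half_sphere\<close> requires.\<close>
  define s where "s = min (e / 4) (min (dx / 2) (min (dz / 2) (if 0 < ?w $ 2 then ?w $ 2 / 2 else 1)))"
  have s: "0 < s" "4 * s \<le> e" "s < dx" "s < dz" "0 < ?w $ 2 \<Longrightarrow> s < ?w $ 2"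
    using e dx dz by (auto simp: s_def min_def)
  obtain D' where D': "D' homeomorphic (UNIV :: (real^2) set)" "D' \<subseteq> ?P" "D' \<subseteq> cball ?w (4 * s)"
    "cball ?w s \<inter> ?P \<subseteq> D'" using half_box[OF s(1) wH] .
  have cb: "cball ?w (4 * s) \<inter> ?H \<subseteq> W" using s e O' by auto
  then have cs: "cball ?w s \<inter> ?H \<subseteq> W" using s(1) by auto
  have csW: "cball ?w s \<inter> W = cball ?w s \<inter> ?H" using cs WH by blast
  have D'W: "D' \<subseteq> W" using D' cb PH by blast
  define D where "D = \<phi> ` D'"
  have DI: "D \<subseteq> ?I" unfolding D_def
  proof (rule image_subsetI)
    fix u assume "u \<in> D'"
    then have "u \<in> W" "0 < u $ 2" using D'W D'(2) by blast+
    then show "\<phi> u \<in> ?I" using intW by blast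
  qed
  have "homeomorphism D' D \<phi> \<psi>"
    unfolding D_def by (rule homeomorphism_of_subsets[OF homeomorphism_symD[OF hom] D'W order_refl]) simp
  from homeomorphism_symD[OF this] have "D homeomorphic D'" unfolding homeomorphic_def by blast
  then have Dhom: "D homeomorphic (UNIV :: (real^2) set)" by (rule homeomorphic_trans[OF _ D'(1)])
  \<comment> \<open>The fixed half circle, without its end points on the boundary of
    \<open>Y\<close>: it has to lie in \<open>D\<close>. The set \<open>\<Sigma>\<close> below
    includes them and is closed.\<close>
  define F where "F = \<phi> ` (sphere ?w s \<inter> ?P)"
  have sub1: "sphere ?w s \<inter> ?P \<subseteq> D'" using D'(4) by auto
  have F: "connected F" "F \<subseteq> D"
  proof -
    show "connected F"
      unfolding F_def
      by (rule connected_continuous_image[OF continuous_on_subset[OF cont\<phi>] connected_half_sphere[OF s(1) wH s(5)]])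
         (use sub1 D'W in blast)
    show "F \<subseteq> D" unfolding F_def D_def using sub1 by (rule image_mono)
  qed
  define Bs where "Bs = \<phi> ` (cball ?w s \<inter> ?H)"
  define \<Sigma> where "\<Sigma> = \<phi> ` (sphere ?w s \<inter> ?H)"
  define Bi where "Bi = \<phi> ` (ball ?w s \<inter> ?H)"
  have "compact (cball ?w s \<inter> ?H)" by (intro compact_Int_closed closed_half_plane compact_cball)
  then have Bs: "closed Bs"
    unfolding Bs_def by (intro compact_imp_closed compact_continuous_image continuous_on_subset[OF cont\<phi> cs])
  have sH: "sphere ?w s \<inter> ?H \<subseteq> W" using cs by auto
  have "compact (sphere ?w s \<inter> ?H)" by (intro compact_Int_closed closed_half_plane compact_sphere)
  then have \<Sigma>: "closed \<Sigma>"
    unfolding \<Sigma>_def by (intro compact_imp_closed compact_continuous_image continuous_on_subset[OF cont\<phi> sH])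
  have open_img: "openin (top_of_set Y) (\<phi> ` (U \<inter> W))" if "open U" for U
    by (rule openin_trans[OF homeomorphism_imp_open_map[OF homeomorphism_symD[OF hom]] V(1)])
       (use that in \<open>auto simp: openin_open\<close>)
  have bW: "ball ?w s' \<inter> ?H = ball ?w s' \<inter> W" if "s' \<le> s" for s'
    using cs WH that by (force simp: subset_iff)
  have Bi: "openin (top_of_set Y) Bi" unfolding Bi_def bW[OF order_refl] by (rule open_img) simp
  have BiBs: "Bi \<subseteq> Bs" unfolding Bi_def Bs_def by auto
  have BsBi: "Bs - Bi \<subseteq> \<Sigma>" unfolding Bi_def Bs_def \<Sigma>_def by force
  have \<Sigma>I: "\<Sigma> \<inter> ?I \<subseteq> F" unfolding \<Sigma>_def F_def using sH intW by auto
  have BsI: "Bs \<inter> ?I \<subseteq> D" unfolding Bs_def D_def using cs intW D'(4) by auto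
  have y\<Sigma>: "y \<notin> \<Sigma>"
  proof
    assume "y \<in> \<Sigma>"
    then obtain u where u: "u \<in> sphere ?w s" "u \<in> W" "y = \<phi> u" unfolding \<Sigma>_def using sH by blast
    then have "u = ?w" using pf by simp
    then show False using u(1) s(1) by simp
  qed
  have "open {u \<in> snd c ` fst c. cinv c u \<in> - \<Sigma>}"
    using open_cinv_image[OF c(1)] \<Sigma> by blast
  moreover have "snd c y \<in> {u \<in> snd c ` fst c. cinv c u \<in> - \<Sigma>}"
    using c y\<Sigma> by simp
  \<comment> \<open>\<open>\<Sigma>\<close> is closed and misses \<open>y\<close>, so a whole
    coordinate disc about \<open>y\<close> misses it. Every circle of radius at most
    \<open>R\<close> then has \<open>F\<close> on its outer side.\<close>
  ultimately obtain R where R: "0 < R" "cball (snd c y) R \<subseteq> {u \<in> snd c ` fst c. cinv c u \<in> - \<Sigma>}"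
    using open_contains_cball by blast
  have crossed: "\<exists>N. open N \<and> y \<in> N \<and> (\<exists>T. connected T \<and> T \<subseteq> sphere (snd c y) r \<and>
       cinv c ` T \<subseteq> ?I \<and>
       (\<forall>\<gamma>. path \<gamma> \<and> path_image \<gamma> \<subseteq> ?I \<and> \<gamma> 0 \<in> N \<and> \<gamma> 1 \<in> - Bs \<longrightarrow>
         (\<exists>t\<in>{0..1}. \<gamma> t \<in> cinv c ` T)))" if r: "0 < r" "r \<le> R" for r
  proof -
    let ?Or = "cinv c ` ball (snd c y) r" and ?Br = "cinv c ` cball (snd c y) r"
      and ?Sr = "cinv c ` sphere (snd c y) r"
    have "cball (snd c y) r \<subseteq> cball (snd c y) R" using r by auto
    then have cr': "cball (snd c y) r \<subseteq> {u \<in> snd c ` fst c. cinv c u \<in> - \<Sigma>}" using R(2) by (rule order_trans)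
    then have cr: "cball (snd c y) r \<subseteq> snd c ` fst c" by blast
    then have br: "ball (snd c y) r \<subseteq> snd c ` fst c" "sphere (snd c y) r \<subseteq> snd c ` fst c" by auto
    have oOr: "open ?Or" by (rule cinv_open[OF c(1) open_ball br(1)])
    have cBr: "closed ?Br" by (rule cinv_compact[OF c(1) compact_cball cr])
    have cSr: "closed ?Sr" by (rule cinv_compact[OF c(1) compact_sphere br(2)])
    note mem = cinv_image_iff[OF c(1) cr] cinv_image_iff[OF c(1) br(1)] cinv_image_iff[OF c(1) br(2)]
    have OrSr: "?Or \<inter> ?Sr = {}" and BrOr: "?Br - ?Or \<subseteq> ?Sr" using mem by force+
    have Br\<Sigma>: "?Br \<inter> \<Sigma> = {}" using cr' by blast
    have SrBr: "?Sr \<subseteq> ?Br" by auto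
    have yOr: "y \<in> ?Or" using mem c r by simp
    have FSr: "F \<inter> ?Br = {}" using Br\<Sigma> PH unfolding F_def \<Sigma>_def by blast
    \<comment> \<open>Next the half disc is shrunk to radius \<open>s'\<close>, so that it lies
      inside the coordinate disc of radius \<open>r\<close>; its interior points form the connected
      set \<open>C\<close>.\<close>
    have "openin (top_of_set W) (\<psi> ` (V \<inter> ?Or))"
      by (rule homeomorphism_imp_open_map[OF hom]) (use oOr in auto)
    then obtain Q where Q: "open Q" "\<psi> ` (V \<inter> ?Or) = W \<inter> Q" by (auto simp: openin_open)
    have "?w \<in> Q" using Q(2) V(2) yOr by blast
    then obtain e' where e': "0 < e'" "ball ?w e' \<subseteq> Q" using Q(1) openE by blast
    define s' where "s' = min s e'"
    have s': "0 < s'" "s' \<le> s" "ball ?w s' \<subseteq> Q" using s e' by (auto simp: s'_def)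
    have nearOr: "\<phi> ` (ball ?w s' \<inter> W) \<subseteq> ?Or"
    proof
      fix q assume "q \<in> \<phi> ` (ball ?w s' \<inter> W)"
      then obtain u where u: "u \<in> W \<inter> Q" "q = \<phi> u" using s' by blast
      then obtain v where "v \<in> V \<inter> ?Or" "u = \<psi> v" unfolding Q(2)[symmetric] by blast
      then show "q \<in> ?Or" using u fp by simp
    qed
    define C where "C = \<phi> ` (ball ?w s' \<inter> ?P)"
    have sub2: "ball ?w s' \<inter> ?P \<subseteq> D'" using D'(4) s' by force
    have C: "connected C" "C \<subseteq> D" "C \<subseteq> ?Or"
    proof -
      have "connected (ball ?w s' \<inter> ?P)"
        by (intro convex_connected convex_Int convex_ball upper_half_plane)
      then show "connected C"
        unfolding C_def by (rule connected_continuous_image[OF continuous_on_subset[OF cont\<phi>], rotated])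
           (use sub2 D'W in blast)
      show "C \<subseteq> D" unfolding C_def D_def using sub2 by blast
      show "C \<subseteq> ?Or" unfolding C_def using nearOr sub2 D'W by blast
    qed
    obtain N where N: "open N" "\<phi> ` (ball ?w s' \<inter> W) = Y \<inter> N"
      using open_img[of "ball ?w s'"] by (auto simp: openin_open)
    have "?w \<in> ball ?w s' \<inter> W" using s' wW by simp
    then have yN: "y \<in> N" using N(2) fp(1)[OF V(2)] by (metis IntD2 imageI)
    have NC: "q \<in> C" if "q \<in> N" "q \<in> ?I" for q
    proof -
      have "q \<in> \<phi> ` (ball ?w s' \<inter> W)" using N(2) that IY by blast
      then obtain u where "u \<in> ball ?w s'" "u \<in> W" "q = \<phi> u" by blast
      then show "q \<in> C" unfolding C_def using intW that(2) by auto
    qed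
    have startC: "\<gamma> 0 \<in> C" if "path_image \<gamma> \<subseteq> ?I" "\<gamma> 0 \<in> N" for \<gamma>
    proof -
      have "\<gamma> 0 \<in> path_image \<gamma>" unfolding path_image_def by (rule imageI) simp
      then show ?thesis using that NC by blast
    qed
    \<comment> \<open>The piece of the path up to its first exit from the half disc consists of
      interior points, hence stays in \<open>D\<close>, and ends on \<open>F\<close>.\<close>
    have exit: "\<exists>E. connected E \<and> E \<subseteq> \<gamma> ` {0..1} \<and> E \<subseteq> D \<and> \<gamma> 0 \<in> E \<and> E \<inter> F \<noteq> {}"
      if g: "path \<gamma>" "path_image \<gamma> \<subseteq> ?I" "\<gamma> 0 \<in> N" "\<gamma> 1 \<in> - Bs" for \<gamma>
    proof -
      have gc: "continuous_on {0..1} \<gamma>" and gI: "\<gamma> ` {0..1} \<subseteq> ?I" using g by (auto simp: path_def path_image_def)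
      then have gY: "\<gamma> ` {0..1} \<subseteq> Y" using IY by blast
      have "\<gamma> 0 \<in> C" by (rule startC[OF g(2,3)])
      then have "\<gamma> 0 \<in> Bi" unfolding C_def Bi_def using PH s'(2) by auto
      moreover have "\<gamma> 1 \<notin> Bi" using g(4) BiBs by blast
      ultimately obtain t where t: "t \<in> {0..1}" "\<gamma> ` {0..<t} \<subseteq> Bi" "\<gamma> t \<in> Bs - Bi"
        using first_exit[OF gc gY Bi Bs BiBs] by metis
      let ?E = "\<gamma> ` {0..t}"
      have "?E \<subseteq> Bs"
      proof
        fix q assume "q \<in> ?E"
        then obtain u where u: "u \<in> {0..t}" "q = \<gamma> u" by blast
        show "q \<in> Bs"
        proof (cases "u = t")
          case False
          then have "u \<in> {0..<t}" using u by simp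
          then show ?thesis using t(2) BiBs u(2) by blast
        qed (use u t in blast)
      qed
      moreover have "?E \<subseteq> \<gamma> ` {0..1}" using t(1) by auto
      moreover have "connected ?E"
        by (rule connected_continuous_image[OF continuous_on_subset[OF gc]]) (use t(1) in auto)
      moreover have "\<gamma> t \<in> F" using t gI BsBi \<Sigma>I by blast
      moreover have "\<gamma> t \<in> ?E" "\<gamma> 0 \<in> ?E" using t(1) by auto
      ultimately show ?thesis using gI BsI by (intro exI[of _ ?E]) blast
    qed
    show ?thesis
    proof (cases "\<exists>p q. p \<in> C \<and> q \<in> F")
      \<comment> \<open>If \<open>C\<close> or \<open>F\<close> is empty, no path of the required
        kind exists and the empty set serves as \<open>T\<close>.\<close>
      case False
      have "\<not> (path \<gamma> \<and> path_image \<gamma> \<subseteq> ?I \<and> \<gamma> 0 \<in> N \<and> \<gamma> 1 \<in> - Bs)" for \<gamma>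
      proof
        assume g: "path \<gamma> \<and> path_image \<gamma> \<subseteq> ?I \<and> \<gamma> 0 \<in> N \<and> \<gamma> 1 \<in> - Bs"
        then have "\<gamma> 0 \<in> C" using startC by blast
        then show False using exit[of \<gamma>] g False by blast
      qed
      then show ?thesis using N(1) yN by (intro exI[of _ N] conjI exI[of _ "{}"]) auto
    next
      case True
      then obtain p q where pq: "p \<in> C" "q \<in> F" by blast
      \<comment> \<open>Off the circle, \<open>?Or\<close> and the complement of \<open>?Br\<close>
        are disjoint open sets covering \<open>E\<close>; the first contains \<open>p\<close>, the
        second \<open>q\<close>.\<close>
      have sep: "q \<notin> E" if E: "connected E" "E \<subseteq> D - ?Sr" "p \<in> E" for E
      proof
        assume "q \<in> E"
        moreover have "E \<subseteq> ?Or \<union> - ?Br" using E(2) BrOr by blast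
        moreover have "?Or \<inter> - ?Br \<inter> E = {}" by auto
        moreover have "p \<in> ?Or" "q \<in> - ?Br" using pq C(3) FSr by auto
        ultimately show False
          using connectedD[OF E(1) oOr, of "- ?Br"] cBr E(3) by blast
      qed
      have pqD: "p \<in> D" "q \<in> D" using pq C(2) F(2) by blast+
      obtain \<sigma> where \<sigma>: "connected \<sigma>" "\<sigma> \<subseteq> D \<inter> ?Sr"
        "\<forall>E. connected E \<and> E \<subseteq> D - \<sigma> \<and> p \<in> E \<longrightarrow> q \<notin> E"
        by (rule separating_component[OF Dhom cSr pqD sep])
      have \<sigma>Sr: "\<sigma> \<subseteq> ?Sr" using \<sigma>(2) by (rule order_trans) (rule Int_lower2)
      have \<sigma>c: "\<sigma> \<subseteq> fst c" using \<sigma>(2) mem by blast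
      have \<sigma>T: "cinv c ` snd c ` \<sigma> = \<sigma>" using \<sigma>c cinv_left[OF c(1)] by force
      have "connected (snd c ` \<sigma>)"
        by (rule connected_continuous_image[OF continuous_on_subset[OF chart_continuous(1)[OF c(1)] \<sigma>c] \<sigma>(1)])
      moreover have "snd c ` \<sigma> \<subseteq> sphere (snd c y) r" using \<sigma>(2) mem by blast
      moreover have "\<exists>t\<in>{0..1}. \<gamma> t \<in> \<sigma>"
        if g: "path \<gamma>" "path_image \<gamma> \<subseteq> ?I" "\<gamma> 0 \<in> N" "\<gamma> 1 \<in> - Bs" for \<gamma>
      proof (rule ccontr)
        assume neg: "\<not> (\<exists>t\<in>{0..1}. \<gamma> t \<in> \<sigma>)"
        obtain E where E: "connected E" "E \<subseteq> \<gamma> ` {0..1}" "E \<subseteq> D" "\<gamma> 0 \<in> E" "E \<inter> F \<noteq> {}"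
          using exit[OF g] by blast
        have g0: "\<gamma> 0 \<in> C" by (rule startC[OF g(2,3)])
        \<comment> \<open>If the path avoided \<open>\<sigma>\<close>, the piece \<open>E\<close>
          would link \<open>C\<close> to \<open>F\<close> within \<open>D - \<sigma>\<close>. As
          \<open>C\<close> and \<open>F\<close> are connected and miss \<open>\<sigma>\<close>, the
          \<open>\<sigma>\<close> found for one pair \<open>p\<close>, \<open>q\<close> stops all
          paths at once.\<close>
        have "connected (C \<union> E)" by (rule connected_Un[OF C(1) E(1)]) (use g0 E in blast)
        then have "connected (C \<union> E \<union> F)" by (rule connected_Un[OF _ F(1)]) (use E in blast)
        moreover have "C \<inter> \<sigma> = {}" using Int_mono[OF C(3) \<sigma>Sr] unfolding OrSr by (rule subset_empty[THEN iffD1])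
        moreover have "F \<inter> \<sigma> = {}"
          using Int_mono[OF order_refl order_trans[OF \<sigma>Sr SrBr], of F] unfolding FSr by (rule subset_empty[THEN iffD1])
        moreover have "E \<inter> \<sigma> = {}" using neg E(2) by auto
        moreover have "C \<union> E \<union> F \<subseteq> D" by (intro Un_least C(2) E(3) F(2))
        ultimately have "connected (C \<union> E \<union> F) \<and> C \<union> E \<union> F \<subseteq> D - \<sigma> \<and> p \<in> C \<union> E \<union> F"
          using pq(1) by auto
        then have "q \<notin> C \<union> E \<union> F" by (rule \<sigma>(3)[rule_format])
        then show False using pq(2) by blast
      qed
      then have "\<forall>\<gamma>. path \<gamma> \<and> path_image \<gamma> \<subseteq> ?I \<and> \<gamma> 0 \<in> N \<and> \<gamma> 1 \<in> - Bs \<longrightarrow>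
          (\<exists>t\<in>{0..1}. \<gamma> t \<in> cinv c ` snd c ` \<sigma>)"
        unfolding \<sigma>T by blast
      moreover have "cinv c ` snd c ` \<sigma> \<subseteq> ?I" unfolding \<sigma>T using \<sigma>(2) DI by blast
      ultimately have "\<exists>T. connected T \<and> T \<subseteq> sphere (snd c y) r \<and> cinv c ` T \<subseteq> ?I \<and>
          (\<forall>\<gamma>. path \<gamma> \<and> path_image \<gamma> \<subseteq> ?I \<and> \<gamma> 0 \<in> N \<and> \<gamma> 1 \<in> - Bs \<longrightarrow>
            (\<exists>t\<in>{0..1}. \<gamma> t \<in> cinv c ` T))"
        by (intro exI[of _ "snd c ` \<sigma>"] conjI)
      then show ?thesis using N(1) yN by (intro exI[of _ N] conjI)
    qed
  qed
  show ?thesis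
  proof (rule that[OF R(1) _ _ _ _ allI[OF impI[OF crossed]]])
    show "open (- Bs)" using Bs by blast
    show "x \<in> - Bs" "z \<in> - Bs" using dx(2)[OF s(3)] dz(2)[OF s(4)] by (auto simp: Bs_def csW)
    show "cball (snd c y) R \<subseteq> snd c ` fst c" using R(2) by blast
  qed simp_all
qed

end

section \<open>The metric axioms\<close>

lemma eventually_rho_filter:
  "eventually P (inf (nhds x) (principal I) \<times>\<^sub>F inf (nhds y) (principal I)) \<longleftrightarrow>
     (\<exists>G H. open G \<and> x \<in> G \<and> open H \<and> y \<in> H \<and> (\<forall>x'\<in>G \<inter> I. \<forall>y'\<in>H \<inter> I. P (x', y')))"
  (is "?L \<longleftrightarrow> ?R")
proof
  assume ?L
  then obtain Q1 Q2 where Q: "eventually Q1 (inf (nhds x) (principal I))"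
    "eventually Q2 (inf (nhds y) (principal I))" "\<And>x' y'. Q1 x' \<Longrightarrow> Q2 y' \<Longrightarrow> P (x', y')"
    by (auto simp: eventually_prod_filter)
  obtain G where "open G" "x \<in> G" "\<And>x'. x' \<in> G \<Longrightarrow> x' \<in> I \<Longrightarrow> Q1 x'"
    using Q(1) by (auto simp: eventually_inf_principal eventually_nhds)
  moreover obtain H where "open H" "y \<in> H" "\<And>y'. y' \<in> H \<Longrightarrow> y' \<in> I \<Longrightarrow> Q2 y'"
    using Q(2) by (auto simp: eventually_inf_principal eventually_nhds)
  ultimately show ?R using Q(3) by (intro exI[of _ G] exI[of _ H]) simp
next
  assume ?R
  then obtain G H where GH: "open G" "x \<in> G" "open H" "y \<in> H"
    "\<And>x' y'. x' \<in> G \<inter> I \<Longrightarrow> y' \<in> H \<inter> I \<Longrightarrow> P (x', y')" by blast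
  have "eventually (\<lambda>x'. x' \<in> G \<inter> I) (inf (nhds x) (principal I))"
    unfolding eventually_inf_principal eventually_nhds using GH by (intro exI[of _ G]) simp
  moreover have "eventually (\<lambda>y'. y' \<in> H \<inter> I) (inf (nhds y) (principal I))"
    unfolding eventually_inf_principal eventually_nhds using GH by (intro exI[of _ H]) simp
  ultimately show ?L
    unfolding eventually_prod_filter using GH(5) by blast
qed

text \<open>With \<open>C = \<infinity>\<close> this still says something: finiteness of
  \<open>rho\<close> forces interior points into every neighbourhood of \<open>x\<close> and of
  \<open>y\<close>.\<close>

lemma rho_lessD:
  assumes "rho A g Y x y < C" "open G" "x \<in> G" "open H" "y \<in> H"
  obtains x' y' where "x' \<in> G" "x' \<in> manifold_interior Y" "y' \<in> H" "y' \<in> manifold_interior Y"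
    "inner_dist A g Y x' y' < C"
proof (rule ccontr)
  assume "\<not> thesis"
  then have "\<forall>x'\<in>G \<inter> manifold_interior Y. \<forall>y'\<in>H \<inter> manifold_interior Y. C \<le> inner_dist A g Y x' y'"
    using that by (meson IntD1 IntD2 not_less)
  then have "eventually (\<lambda>z. C \<le> (case z of (x', y') \<Rightarrow> inner_dist A g Y x' y'))
      (inf (nhds x) (principal (manifold_interior Y)) \<times>\<^sub>F inf (nhds y) (principal (manifold_interior Y)))"
    unfolding eventually_rho_filter using assms by (intro exI[of _ G] exI[of _ H]) simp
  then have "C \<le> rho A g Y x y"
    unfolding rho_def by (rule Liminf_bounded)
  then show False using assms(1) by simp
qed

text \<open>The slack from \<open>C\<close> to \<open>D\<close> is what lets approximate paths be
  used; density of the extended reals removes it.\<close>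

lemma rho_leI:
  assumes "\<And>D G H. C < D \<Longrightarrow> open G \<Longrightarrow> x \<in> G \<Longrightarrow> open H \<Longrightarrow> y \<in> H \<Longrightarrow>
    \<exists>x'\<in>G \<inter> manifold_interior Y. \<exists>y'\<in>H \<inter> manifold_interior Y. inner_dist A g Y x' y' \<le> D"
  shows "rho A g Y x y \<le> C"
proof (rule ccontr)
  assume "\<not> ?thesis"
  then obtain D where D: "C < D" "D < rho A g Y x y" using dense not_le by metis
  have "eventually (\<lambda>z. D < (case z of (x', y') \<Rightarrow> inner_dist A g Y x' y'))
      (inf (nhds x) (principal (manifold_interior Y)) \<times>\<^sub>F inf (nhds y) (principal (manifold_interior Y)))"
    using D(2) le_Liminf_iff[of "rho A g Y x y"] unfolding rho_def by blast
  then obtain G H where GH: "open G" "x \<in> G" "open H" "y \<in> H"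
    "\<forall>x'\<in>G \<inter> manifold_interior Y. \<forall>y'\<in>H \<inter> manifold_interior Y. D < inner_dist A g Y x' y'"
    unfolding eventually_rho_filter by auto
  then show False using assms[OF D(1) GH(1-4)] by force
qed

context riemannian_surface
begin

lemma rho_nonneg: "0 \<le> rho A g Y x y"
  unfolding rho_def by (intro Liminf_bounded always_eventually) (auto simp: inner_dist_nonneg)

lemma rho_sym: "rho A g Y x y = rho A g Y y x"
proof -
  have "rho A g Y x y \<le> rho A g Y y x" for x y
  proof (rule rho_leI)
    fix D G H assume as: "rho A g Y y x < D" "open G" "x \<in> G" "open H" "y \<in> H"
    obtain y' x' where "y' \<in> H" "y' \<in> manifold_interior Y" "x' \<in> G" "x' \<in> manifold_interior Y"
      "inner_dist A g Y y' x' < D"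
      by (rule rho_lessD[OF as(1,4,5,2,3)])
    then show "\<exists>x'\<in>G \<inter> manifold_interior Y. \<exists>y'\<in>H \<inter> manifold_interior Y. inner_dist A g Y x' y' \<le> D"
      using inner_dist_sym[of Y x' y'] by (intro bexI[of _ x'] bexI[of _ y']) auto
  qed
  then show ?thesis by (intro antisym)
qed

text \<open>Finiteness supplies interior points \<open>x'\<close> arbitrarily close to
  \<open>x\<close>, and the pair \<open>(x', x')\<close> has inner distance 0 by the constant
  path.\<close>

lemma rho_refl:
  assumes "rho A g Y x x < \<infinity>"
  shows "rho A g Y x x = 0"
proof (intro antisym rho_nonneg rho_leI)
  fix D :: ereal and G H assume as: "0 < D" "open G" "x \<in> G" "open H" "x \<in> H"
  have GH: "open (G \<inter> H)" "x \<in> G \<inter> H" using as by auto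
  obtain x' y' where "x' \<in> G \<inter> H" "x' \<in> manifold_interior Y"
    by (rule rho_lessD[OF assms GH GH])
  then show "\<exists>x'\<in>G \<inter> manifold_interior Y. \<exists>y'\<in>H \<inter> manifold_interior Y. inner_dist A g Y x' y' \<le> D"
    using as(1) inner_dist_refl[of x' Y] by (intro bexI[of _ x']) auto
qed

text \<open>A path from the disc of radius \<open>R / 2\<close> to the outside of the disc of radius
  \<open>R\<close> covers a coordinate distance of at least \<open>R / 2\<close>, which costs
  \<open>m * (R / 2)\<close>. The bound is uniform over neighbourhoods of \<open>x\<close> and
  \<open>y\<close> and so survives the limit inferior.\<close>

lemma rho_pos:
  assumes "x \<noteq> y"
  shows "0 < rho A g Y x y"
proof -
  obtain c where c: "c \<in> A" "x \<in> fst c" by (rule ex_chart)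
  let ?x = "snd c x"
  have "open {u \<in> snd c ` fst c. cinv c u \<in> - {y}}"
    by (rule open_cinv_image[OF c(1) open_Compl[OF closed_singleton]])
  moreover have "?x \<in> {u \<in> snd c ` fst c. cinv c u \<in> - {y}}" using c assms by simp
  \<comment> \<open>The closed disc omits \<open>y\<close>, so its complement is a neighbourhood of
    \<open>y\<close>.\<close>
  ultimately obtain R where R: "0 < R" "cball ?x R \<subseteq> {u \<in> snd c ` fst c. cinv c u \<in> - {y}}"
    using open_contains_cball by blast
  then have cR: "cball ?x R \<subseteq> snd c ` fst c" by blast
  then have bR: "ball ?x R \<subseteq> snd c ` fst c" "ball ?x (R / 2) \<subseteq> snd c ` fst c" using R(1) by auto
  obtain m where m: "0 < m" "\<And>u v. u \<in> cball ?x R \<Longrightarrow> m * norm v \<le> sqrt (g c (cinv c u) v v)"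
    using metric_bounds[OF c(1) compact_cball cR] by metis
  let ?B = "cinv c ` ball ?x R" and ?B' = "cinv c ` cball ?x R" and ?B2 = "cinv c ` ball ?x (R / 2)"
  have clB: "closed ?B'" by (rule cinv_compact[OF c(1) compact_cball cR])
  have opB: "open ?B" by (rule cinv_open[OF c(1) open_ball bR(1)])
  have opB2: "open ?B2" by (rule cinv_open[OF c(1) open_ball bR(2)])
  note mem = cinv_image_iff[OF c(1) cR] cinv_image_iff[OF c(1) bR(1)] cinv_image_iff[OF c(1) bR(2)]
  have xB2: "x \<in> ?B2" using mem c R(1) by simp
  have yB: "y \<in> - ?B'" using R(2) by blast
  have low: "ereal (m * (R / 2)) \<le> inner_dist A g Y x' y'" if x': "x' \<in> ?B2" and y': "y' \<in> - ?B'" for x' y'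
    unfolding inner_dist_def
  proof (rule INF_greatest)
    fix \<gamma> assume "\<gamma> \<in> {\<gamma>. smooth_path A \<gamma> \<and> path_image \<gamma> \<subseteq> manifold_interior Y \<and>
               pathstart \<gamma> = x' \<and> pathfinish \<gamma> = y'}"
    then have sp: "smooth_path A \<gamma>" and ends: "\<gamma> 0 = x'" "\<gamma> 1 = y'"
      by (auto simp: pathstart_def pathfinish_def)
    have gc: "continuous_on {0..1} \<gamma>" using sp by (simp add: smooth_path_def path_def)
    have g0: "\<gamma> 0 \<in> ?B" using x' ends mem R(1) by simp
    have BB': "?B \<subseteq> ?B'" by auto
    then have g1: "\<gamma> 1 \<notin> ?B" using y' ends by blast
    obtain t where t: "t \<in> {0..1}" "\<gamma> ` {0..<t} \<subseteq> ?B" "\<gamma> t \<in> ?B' - ?B"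
      by (rule first_exit[OF gc subset_UNIV _ clB BB' g0 g1]) (use opB in auto)
    have "m * norm (snd c (\<gamma> t) - snd c (\<gamma> 0)) \<le> path_length A g \<gamma>"
    proof (rule path_length_ge_chord[OF sp c(1) t(1) m(1) _ m(2)])
      fix s assume s: "s \<in> {0..t}"
      have "\<gamma> s \<in> ?B'"
      proof (cases "s = t")
        case False
        then have "s \<in> {0..<t}" using s by simp
        then show ?thesis using t(2) BB' by blast
      qed (use t(3) in blast)
      then show "\<gamma> s \<in> fst c \<and> snd c (\<gamma> s) \<in> cball ?x R" using mem by blast
    qed
    moreover have "R / 2 \<le> norm (snd c (\<gamma> t) - snd c (\<gamma> 0))"
    proof -
      have "R \<le> dist ?x (snd c (\<gamma> t))" using t(3) mem by auto
      moreover have "dist ?x (snd c (\<gamma> 0)) < R / 2" using x' ends mem by auto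
      ultimately show ?thesis
        using dist_triangle[of ?x "snd c (\<gamma> t)" "snd c (\<gamma> 0)"] by (simp add: dist_norm norm_minus_commute)
    qed
    then have "m * (R / 2) \<le> m * norm (snd c (\<gamma> t) - snd c (\<gamma> 0))" using m(1) by simp
    ultimately show "ereal (m * (R / 2)) \<le> ereal (path_length A g \<gamma>)" by simp
  qed
  have "ereal (m * (R / 2)) \<le> rho A g Y x y"
  proof (rule ccontr)
    assume "\<not> ?thesis"
    then have less: "rho A g Y x y < ereal (m * (R / 2))" by simp
    obtain x' y' where "x' \<in> ?B2" "y' \<in> - ?B'" "inner_dist A g Y x' y' < ereal (m * (R / 2))"
      by (rule rho_lessD[OF less opB2 xB2 open_Compl[OF clB] yB])
    then show False using low[of x' y'] by simp
  qed
  moreover have "0 < ereal (m * (R / 2))" using m(1) R(1) by simp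
  ultimately show ?thesis by (rule less_le_trans[rotated])
qed

lemma rho_triangle:
  assumes Y: "C0_submanifold_with_boundary Y" and y: "y \<in> Y" "x \<noteq> y" "z \<noteq> y"
    and fin: "rho A g Y x y < \<infinity>" "rho A g Y y z < \<infinity>"
  shows "rho A g Y x z \<le> rho A g Y x y + rho A g Y y z"
proof -
  obtain a where a: "rho A g Y x y = ereal a"
    using fin(1) rho_nonneg[of Y x y] by (cases "rho A g Y x y") auto
  obtain b where b: "rho A g Y y z = ereal b"
    using fin(2) rho_nonneg[of Y y z] by (cases "rho A g Y y z") auto
  obtain c where c: "c \<in> A" "y \<in> fst c" by (rule ex_chart)
  obtain R G0 where R: "0 < R" "open G0" "x \<in> G0" "z \<in> G0"
    and cR: "cball (snd c y) R \<subseteq> snd c ` fst c"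
    and cross: "\<forall>r. 0 < r \<and> r \<le> R \<longrightarrow> (\<exists>N. open N \<and> y \<in> N \<and> (\<exists>T. connected T \<and> T \<subseteq> sphere (snd c y) r \<and>
       cinv c ` T \<subseteq> manifold_interior Y \<and>
       (\<forall>\<gamma>. path \<gamma> \<and> path_image \<gamma> \<subseteq> manifold_interior Y \<and> \<gamma> 0 \<in> N \<and> \<gamma> 1 \<in> G0 \<longrightarrow>
         (\<exists>t\<in>{0..1}. \<gamma> t \<in> cinv c ` T))))"
    by (rule crossing[OF Y y c])
  obtain M where M: "0 < M" "\<And>u v. u \<in> cball (snd c y) R \<Longrightarrow> sqrt (g c (cinv c u) v v) \<le> M * norm v"
    using metric_bounds[OF c(1) compact_cball cR] by metis
  show ?thesis
  proof (rule rho_leI)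
    fix D G H assume D: "rho A g Y x y + rho A g Y y z < D" and GH: "open G" "x \<in> G" "open H" "z \<in> H"
    \<comment> \<open>One \<open>\<epsilon>\<close> for each of the two near-optimal paths and one
      for the arc between them.\<close>
    obtain \<epsilon> where \<epsilon>: "0 < \<epsilon>" "ereal (a + b + 3 * \<epsilon>) \<le> D"
    proof (cases D)
      case (real d)
      then have "a + b < d" using D a b by simp
      then show ?thesis using real by (intro that[of "(d - a - b) / 3"]) (simp_all add: field_simps)
    next
      case PInf
      then show ?thesis using that[of 1] by simp
    qed (use D in simp)
    \<comment> \<open>\<open>M\<close> belongs to the fixed disc of radius \<open>R\<close>, so
      \<open>r\<close> can be chosen after it, small enough for the bound of
      \<open>inner_dist_arc\<close> to be at most \<open>\<epsilon>\<close>.\<close>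
    define r where "r = min R (\<epsilon> / (4 * pi * M))"
    have r: "0 < r" "r \<le> R" using R(1) \<epsilon>(1) M(1) by (auto simp: r_def)
    have rM: "4 * pi * M * r \<le> \<epsilon>"
    proof -
      have "r \<le> \<epsilon> / (4 * pi * M)" by (simp add: r_def)
      then have "4 * pi * M * r \<le> 4 * pi * M * (\<epsilon> / (4 * pi * M))"
        using M(1) by (intro mult_left_mono) auto
      then show ?thesis using M(1) by simp
    qed
    obtain N T where N: "open N" "y \<in> N" and T: "connected T" "T \<subseteq> sphere (snd c y) r"
      "cinv c ` T \<subseteq> manifold_interior Y"
      and meet: "\<forall>\<gamma>. path \<gamma> \<and> path_image \<gamma> \<subseteq> manifold_interior Y \<and> \<gamma> 0 \<in> N \<and> \<gamma> 1 \<in> G0 \<longrightarrow>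
         (\<exists>t\<in>{0..1}. \<gamma> t \<in> cinv c ` T)"
      using cross[THEN spec, THEN mp, OF conjI[OF r]] by (elim exE conjE)
    \<comment> \<open>Used for both \<open>x\<close> and \<open>z\<close>, with the same
      \<open>T\<close>: a near-optimal path that starts in \<open>N\<close> is cut at a point of
      \<open>T\<close>, and only the part beyond that point is kept.\<close>
    have branch: "\<exists>x'\<in>G \<inter> manifold_interior Y. \<exists>u\<in>T. inner_dist A g Y x' (cinv c u) \<le> ereal (e + \<epsilon>)"
      if e: "rho A g Y y x = ereal e" and G: "open G" "x \<in> G" "x \<in> G0" for x e G
    proof -
      have less: "rho A g Y y x < ereal (e + \<epsilon>)" using e \<epsilon>(1) by simp
      have GG: "open (G \<inter> G0)" "x \<in> G \<inter> G0" using G R(2) by auto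
      obtain y1 x' where p: "y1 \<in> N" "x' \<in> G \<inter> G0" "x' \<in> manifold_interior Y"
        "inner_dist A g Y y1 x' < ereal (e + \<epsilon>)"
        by (rule rho_lessD[OF less N GG])
      obtain \<gamma> where \<gamma>: "smooth_path A \<gamma>" "path_image \<gamma> \<subseteq> manifold_interior Y" "\<gamma> 0 = y1" "\<gamma> 1 = x'"
        "ereal (path_length A g \<gamma>) < ereal (e + \<epsilon>)"
        by (rule inner_dist_lessE[OF p(4)])
      have "path \<gamma>" using \<gamma>(1) by (simp add: smooth_path_def)
      then have "\<exists>t\<in>{0..1}. \<gamma> t \<in> cinv c ` T"
        using \<gamma> p by (intro meet[THEN spec, THEN mp]) simp
      then obtain t u where t: "t \<in> {0..1}" "u \<in> T" "\<gamma> t = cinv c u" by (elim bexE imageE)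
      have "inner_dist A g Y (\<gamma> 1) (\<gamma> t) \<le> ereal (path_length A g \<gamma>)"
        by (rule inner_dist_subpath[OF \<gamma>(1,2) _ t(1)]) simp
      then have "inner_dist A g Y x' (cinv c u) \<le> ereal (e + \<epsilon>)"
        using \<gamma>(4,5) t(3) by (simp add: order_trans[OF _ less_imp_le])
      then show ?thesis using p t(2) by blast
    qed
    have "rho A g Y y x = ereal a" using a rho_sym by simp
    from branch[OF this GH(1,2) R(3)] obtain x' u where x': "x' \<in> G \<inter> manifold_interior Y" "u \<in> T"
      "inner_dist A g Y x' (cinv c u) \<le> ereal (a + \<epsilon>)" by blast
    from branch[OF b GH(3,4) R(4)] obtain z' v where z': "z' \<in> H \<inter> manifold_interior Y" "v \<in> T"
      "inner_dist A g Y z' (cinv c v) \<le> ereal (b + \<epsilon>)" by blast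
    have TR: "T \<subseteq> cball (snd c y) R" using T(2) r(2) by auto
    have "inner_dist A g Y (cinv c u) (cinv c v) \<le> ereal (4 * pi * M * r)"
      by (rule inner_dist_arc[OF c(1) T(1,2) r(1) order_trans[OF TR cR] T(3) x'(2) z'(2) M(1)])
         (use M(2) TR in blast)
    also have "\<dots> \<le> ereal \<epsilon>" using rM by simp
    finally have uv: "inner_dist A g Y (cinv c u) (cinv c v) \<le> ereal \<epsilon>" .
    have "inner_dist A g Y x' z' \<le> inner_dist A g Y x' (cinv c u) + inner_dist A g Y (cinv c u) z'"
      by (rule inner_dist_triangle)
    also have "\<dots> \<le> inner_dist A g Y x' (cinv c u) +
        (inner_dist A g Y (cinv c u) (cinv c v) + inner_dist A g Y (cinv c v) z')"
      by (intro add_left_mono inner_dist_triangle)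
    also have "\<dots> \<le> ereal (a + \<epsilon>) + (ereal \<epsilon> + ereal (b + \<epsilon>))"
      using x'(3) uv z'(3) inner_dist_sym[of Y z'] by (intro add_mono) auto
    also have "\<dots> = ereal (a + b + 3 * \<epsilon>)" by simp
    also have "\<dots> \<le> D" by (rule \<epsilon>(2))
    finally show "\<exists>x'\<in>G \<inter> manifold_interior Y. \<exists>z'\<in>H \<inter> manifold_interior Y. inner_dist A g Y x' z' \<le> D"
      using x'(1) z'(1) by blast
  qed
qed

end

theorem theorem2p1:
  fixes A :: "'a::{t2_space,second_countable_topology} chart set"
    and g :: "'a metric_tensor"
    and Y :: "'a set"
  assumes "smooth_atlas A"
    and "connected (UNIV :: 'a set)"
    and "riemannian_metric A g"
    and "C0_submanifold_with_boundary Y"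
    and "compact Y"
    and "connected Y"
    and "manifold_boundary Y \<noteq> {}"
    and "\<And>x y. x \<in> Y \<Longrightarrow> y \<in> Y \<Longrightarrow> rho A g Y x y < \<infinity>"
  shows "Metric_space Y (\<lambda>x y. real_of_ereal (rho A g Y x y))"
proof -
  interpret riemannian_surface A g
    using assms(1,3) by unfold_locales
  note fin = assms(8)
  \<comment> \<open>Finite and nonnegative values lose nothing in passing to the reals.\<close>
  have real: "ereal (real_of_ereal (rho A g Y x y)) = rho A g Y x y" if "x \<in> Y" "y \<in> Y" for x y
    using fin[OF that] rho_nonneg[of Y x y] by (intro ereal_real') (cases "rho A g Y x y"; auto)
  show ?thesis
  proof
    show "0 \<le> real_of_ereal (rho A g Y x y)" for x y
      using rho_nonneg by (rule real_of_ereal_pos)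
    show "real_of_ereal (rho A g Y x y) = real_of_ereal (rho A g Y y x)" for x y
      using rho_sym by simp
    show "real_of_ereal (rho A g Y x y) = 0 \<longleftrightarrow> x = y" if xy: "x \<in> Y" "y \<in> Y" for x y
    proof
      assume "real_of_ereal (rho A g Y x y) = 0"
      then have "rho A g Y x y = 0" using real[OF xy] by (simp add: zero_ereal_def)
      then show "x = y" using rho_pos[of x y Y] by auto
    qed (use rho_refl[OF fin[OF xy(1) xy(1)]] in simp)
    show "real_of_ereal (rho A g Y x z) \<le> real_of_ereal (rho A g Y x y) + real_of_ereal (rho A g Y y z)"
      if xyz: "x \<in> Y" "y \<in> Y" "z \<in> Y" for x y z
    proof -
      have "rho A g Y x z \<le> rho A g Y x y + rho A g Y y z"
      \<comment> \<open>\<open>rho_triangle\<close> needs \<open>x\<close> and \<open>z\<close>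
        distinct from \<open>y\<close>, so that both lie outside a half disc at \<open>y\<close>.
        Otherwise one summand on the right is 0 and the other is the left side.\<close>
      proof (cases "x = y \<or> z = y")
        case True
        then show ?thesis using rho_refl[OF fin[OF xyz(2) xyz(2)]] by auto
      next
        case False
        then show ?thesis
          using rho_triangle[OF assms(4) xyz(2) _ _ fin[OF xyz(1,2)] fin[OF xyz(2,3)]] by blast
      qed
      then have "ereal (real_of_ereal (rho A g Y x z)) \<le>
          ereal (real_of_ereal (rho A g Y x y)) + ereal (real_of_ereal (rho A g Y y z))"
        using real xyz by simp
      then show ?thesis by simp
    qed
  qed
qed

end
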